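(* Let $R$ be an algebraically closed field of characteristic different from $p$, let $\psi:\mathbf{k}\to R^\times$ be a non-trivial character, and let $\pi$ be an irreducible $R$-representation of $\mathrm{GL}_n(\mathbf{k})$. Suppose that $\pi$ is a subquotient of $\pi'\times\mathbf{1}^{k}$, where $\mathbf{1}$ is the trivial character of $\mathrm{GL}_1(\mathbf{k})=\mathbf{k}^\times$, $\pi'\times \mathbf{1}^k=\pi'\times\mathbf{1}\times\cdots\times\mathbf{1}$ ($k$ copies of $\mathbf 1$), and $\pi'$ is a subquotient of a representation parabolically induced from cuspidal representations all different from $\mathbf{1}$. Then $$\gamma(\pi,\psi)=(-q^{-1/2})^{k}\,\gamma(\pi',\psi)\quad\text{and}\quad \gamma(\pi,\psi)\,\gamma(\pi^\vee,\psi^{-1})=q^{-k}.$$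
   Context: $\mathbf{k}$ is a finite field of characteristic $p$ and cardinality $q$. A square root $q^{1/2}$ of $q$ in $R$ is fixed, $q^{-1/2}$ is its inverse, and $|M_m(\mathbf{k})|^{1/2}:=(q^{1/2})^{m^2}$ for all $m\ge1$. For an $R$-representation $(\rho,V)$ of $G_m=\mathrm{GL}_m(\mathbf{k})$ with dual $V^\vee=\mathrm{Hom}_R(V,R)$ and contragredient $\rho^\vee$, the gamma factor $\gamma(\rho,\psi)\in R$ (when it exists, as it does for all representations in the claim) is the scalar such that $$\sum_{g\in G_m}\widehat\Phi(g)v^\vee(\rho(g^{-1})v)=\gamma(\rho,\psi)\sum_{g\in G_m}\Phi(g)v^\vee(\rho(g)v)$$ for all $v\in V$, $v^\vee\in V^\vee$ and all $\Phi:M_m(\mathbf{k})\to R$ supported on $G_m$, where $\widehat\Phi(a)=|M_m(\mathbf{k})|^{-1/2}\sum_{g\in M_m(\mathbf{k})}\Phi(g)\psi(\mathrm{tr}(ga))$. Equivalently it is the scalar by which $|M_m(\mathbf{k})|^{-1/2}\sum_{g\in G_m}\psi(\mathrm{tr}(g))\rho^\vee(g)$ acts. $\times$ denotes parabolic induction from block upper triangular parabolic subgroups. A representation is cuspidal if its coinvariants under the unipotent radical of every proper parabolic subgroup vanish; cuspidal representations here are irreducible. *)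

theory Defs
  imports
    "Jordan_Normal_Form.Matrix"
    "HOL-Computational_Algebra.Computational_Algebra"
    "HOL-Library.Function_Algebras"
    "HOL-Library.Cardinality"
begin

section \<open>General linear groups and parabolic subgroups\<close>

definition GLgroup :: "nat \<Rightarrow> 'k::field mat monoid" where
  "GLgroup m = units_of (ring_mat TYPE('k) m ())"

abbreviation GL :: "nat \<Rightarrow> 'k::field mat set" where
  "GL m \<equiv> carrier (GLgroup m)"

abbreviation GLinv :: "nat \<Rightarrow> 'k::field mat \<Rightarrow> 'k mat" where
  "GLinv m g \<equiv> inv\<^bsub>GLgroup m\<^esub> g"

definition mtrace :: "'k::field mat \<Rightarrow> 'k" where
  "mtrace A = (\<Sum>i<dim_row A. A $$ (i, i))"

text \<open>A list \<open>ns\<close> of block sizes cuts the indices below \<open>sum_list ns\<close> into consecutive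
  blocks; block number \<open>t\<close> starts at \<open>offset ns t\<close>.\<close>

definition offset :: "nat list \<Rightarrow> nat \<Rightarrow> nat" where
  "offset ns t = sum_list (take t ns)"

definition dblock :: "nat list \<Rightarrow> nat \<Rightarrow> 'k mat \<Rightarrow> 'k mat" where
  "dblock ns t g = mat (ns ! t) (ns ! t) (\<lambda>(i, j). g $$ (offset ns t + i, offset ns t + j))"

definition std_parabolic :: "nat list \<Rightarrow> 'k::field mat set" where
  "std_parabolic ns = {g \<in> GL (sum_list ns).
     \<forall>t<length ns. \<forall>i<sum_list ns. \<forall>j<sum_list ns.
       offset ns t \<le> i \<and> j < offset ns t \<longrightarrow> g $$ (i, j) = 0}"

definition std_unipotent :: "nat list \<Rightarrow> 'k::field mat set" where
  "std_unipotent ns = {g \<in> std_parabolic ns. \<forall>t<length ns. dblock ns t g = 1\<^sub>m (ns ! t)}"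

text \<open>Unipotent radicals of the proper parabolic subgroups: every proper parabolic subgroup is
  conjugate to a block upper triangular one with at least two blocks.\<close>

definition unipotent_radicals :: "nat \<Rightarrow> 'k::field mat set set" where
  "unipotent_radicals m = {(\<lambda>u. h * u * GLinv m h) ` std_unipotent ns | ns h.
     2 \<le> length ns \<and> (\<forall>a\<in>set ns. 0 < a) \<and> sum_list ns = m \<and> h \<in> GL m}"

section \<open>Representations\<close>

text \<open>A representation of \<open>GL rdeg\<close> on the subspace \<open>rspace\<close> of the vector space formed by
  the type \<open>'v\<close> with the scalar multiplication \<open>rscale\<close>.  Values of \<open>ract\<close> outside \<open>GL rdeg\<close>
  and \<open>rspace\<close> are irrelevant.\<close>

record ('k, 'r, 'v) rep =
  rdeg :: nat
  rscale :: "'r \<Rightarrow> 'v \<Rightarrow> 'v"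
  rspace :: "'v set"
  ract :: "'k mat \<Rightarrow> 'v \<Rightarrow> 'v"

definition linear_between ::
  "('r \<Rightarrow> 'v \<Rightarrow> 'v) \<Rightarrow> 'v set \<Rightarrow> ('r \<Rightarrow> 'w \<Rightarrow> 'w) \<Rightarrow> ('v::plus \<Rightarrow> 'w::plus) \<Rightarrow> bool" where
  "linear_between s V s' f \<longleftrightarrow>
     (\<forall>x\<in>V. \<forall>y\<in>V. f (x + y) = f x + f y) \<and> (\<forall>a. \<forall>x\<in>V. f (s a x) = s' a (f x))"

definition is_rep :: "('k::field, 'r::field, 'v::ab_group_add) rep \<Rightarrow> bool" where
  "is_rep \<rho> \<longleftrightarrow>
     vector_space (rscale \<rho>) \<and> Modules.module.subspace (rscale \<rho>) (rspace \<rho>) \<and>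
     (\<forall>g\<in>GL (rdeg \<rho>). ract \<rho> g ` rspace \<rho> \<subseteq> rspace \<rho> \<and>
        linear_between (rscale \<rho>) (rspace \<rho>) (rscale \<rho>) (ract \<rho> g)) \<and>
     (\<forall>v\<in>rspace \<rho>. ract \<rho> (1\<^sub>m (rdeg \<rho>)) v = v) \<and>
     (\<forall>g\<in>GL (rdeg \<rho>). \<forall>h\<in>GL (rdeg \<rho>). \<forall>v\<in>rspace \<rho>.
        ract \<rho> (g * h) v = ract \<rho> g (ract \<rho> h v))"

definition invariant_subspace ::
  "('k::field, 'r::field, 'v::ab_group_add) rep \<Rightarrow> 'v set \<Rightarrow> bool" where
  "invariant_subspace \<rho> U \<longleftrightarrow>
     Modules.module.subspace (rscale \<rho>) U \<and> U \<subseteq> rspace \<rho> \<and>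
     (\<forall>g\<in>GL (rdeg \<rho>). ract \<rho> g ` U \<subseteq> U)"

definition irreducible_rep :: "('k::field, 'r::field, 'v::ab_group_add) rep \<Rightarrow> bool" where
  "irreducible_rep \<rho> \<longleftrightarrow>
     is_rep \<rho> \<and> rspace \<rho> \<noteq> {0} \<and>
     (\<forall>U. invariant_subspace \<rho> U \<longrightarrow> U = {0} \<or> U = rspace \<rho>)"

definition rep_hom_on ::
  "('k::field, 'r::field, 'v::ab_group_add) rep \<Rightarrow> 'v set \<Rightarrow>
   ('k, 'r, 'w::ab_group_add) rep \<Rightarrow> ('v \<Rightarrow> 'w) \<Rightarrow> bool" where
  "rep_hom_on \<rho> U \<tau> f \<longleftrightarrow>
     linear_between (rscale \<rho>) U (rscale \<tau>) f \<and> f ` U \<subseteq> rspace \<tau> \<and>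
     (\<forall>g\<in>GL (rdeg \<rho>). \<forall>u\<in>U. f (ract \<rho> g u) = ract \<tau> g (f u))"

definition rep_iso ::
  "('k::field, 'r::field, 'v::ab_group_add) rep \<Rightarrow>
   ('k, 'r, 'w::ab_group_add) rep \<Rightarrow> bool" where
  "rep_iso \<rho> \<tau> \<longleftrightarrow> rdeg \<rho> = rdeg \<tau> \<and>
     (\<exists>f. rep_hom_on \<rho> (rspace \<rho>) \<tau> f \<and> bij_betw f (rspace \<rho>) (rspace \<tau>))"

text \<open>\<open>\<pi>\<close> is isomorphic to \<open>U / W\<close> for invariant subspaces \<open>W \<subseteq> U\<close> of \<open>\<tau>\<close>; the isomorphism is
  given as an equivariant surjection from \<open>U\<close> with kernel \<open>W\<close>.\<close>

definition subquotient ::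
  "('k::field, 'r::field, 'v::ab_group_add) rep \<Rightarrow>
   ('k, 'r, 'w::ab_group_add) rep \<Rightarrow> bool" where
  "subquotient \<pi> \<tau> \<longleftrightarrow> rdeg \<pi> = rdeg \<tau> \<and>
     (\<exists>U W f. invariant_subspace \<tau> U \<and> invariant_subspace \<tau> W \<and> W \<subseteq> U \<and>
        rep_hom_on \<tau> U \<pi> f \<and> f ` U = rspace \<pi> \<and> {u \<in> U. f u = 0} = W)"

definition triv_rep :: "('k::field, 'r::field, 'r) rep" where
  "triv_rep = \<lparr>rdeg = 1, rscale = (*), rspace = UNIV, ract = (\<lambda>g v. v)\<rparr>"

text \<open>Functionals are normalised to vanish outside \<open>rspace \<rho>\<close>, so that each element of the dual
  is one function.\<close>

definition dual_rep ::
  "('k::field, 'r::field, 'v::ab_group_add) rep \<Rightarrow> ('k, 'r, 'v \<Rightarrow> 'r) rep" where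
  "dual_rep \<rho> =
     \<lparr>rdeg = rdeg \<rho>,
      rscale = (\<lambda>a \<phi> v. a * \<phi> v),
      rspace = {\<phi>. linear_between (rscale \<rho>) (rspace \<rho>) (*) \<phi> \<and> (\<forall>v. v \<notin> rspace \<rho> \<longrightarrow> \<phi> v = 0)},
      ract = (\<lambda>g \<phi> v. if v \<in> rspace \<rho> then \<phi> (ract \<rho> (GLinv (rdeg \<rho>) g) v) else 0)\<rparr>"

section \<open>Cuspidal representations\<close>

definition coinv_kernel ::
  "('k::field, 'r::field, 'v::ab_group_add) rep \<Rightarrow> 'k mat set \<Rightarrow> 'v set" where
  "coinv_kernel \<rho> H =
     Modules.module.span (rscale \<rho>) {ract \<rho> h v - v | h v. h \<in> H \<and> v \<in> rspace \<rho>}"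

text \<open>The coinvariants, as the set of cosets of the kernel; they vanish iff the only coset is
  the kernel itself.\<close>

definition coinvariants ::
  "('k::field, 'r::field, 'v::ab_group_add) rep \<Rightarrow> 'k mat set \<Rightarrow> 'v set set" where
  "coinvariants \<rho> H = (\<lambda>v. (+) v ` coinv_kernel \<rho> H) ` rspace \<rho>"

definition cuspidal :: "('k::field, 'r::field, 'v::ab_group_add) rep \<Rightarrow> bool" where
  "cuspidal \<rho> \<longleftrightarrow> irreducible_rep \<rho> \<and> 0 < rdeg \<rho> \<and>
     (\<forall>N\<in>unipotent_radicals (rdeg \<rho>). coinvariants \<rho> N = {coinv_kernel \<rho> N})"

section \<open>Parabolic induction\<close>

definition tuples :: "('k, 'r, 'v) rep list \<Rightarrow> 'v list set" where
  "tuples \<rho>s = {xs. length xs = length \<rho>s \<and> (\<forall>t<length \<rho>s. xs ! t \<in> rspace (\<rho>s ! t))}"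

definition multilinear_form ::
  "('k, 'r::field, 'v::ab_group_add) rep list \<Rightarrow> ('v list \<Rightarrow> 'r) \<Rightarrow> bool" where
  "multilinear_form \<rho>s \<beta> \<longleftrightarrow>
     (\<forall>xs\<in>tuples \<rho>s. \<forall>t<length \<rho>s.
        linear_between (rscale (\<rho>s ! t)) (rspace (\<rho>s ! t)) (*) (\<lambda>x. \<beta> (xs[t := x])))"

text \<open>The tensor product of the spaces of the \<open>\<rho>s\<close> is realised inside the dual of the space of
  multilinear forms on them (into which it embeds, the scalars forming a field): the pure tensor
  of \<open>xs\<close> is evaluation at \<open>xs\<close>.  For the empty list this is one-dimensional.\<close>

definition pure_tensor ::
  "('k, 'r::field, 'v::ab_group_add) rep list \<Rightarrow> 'v list \<Rightarrow> ('v list \<Rightarrow> 'r) \<Rightarrow> 'r" where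
  "pure_tensor \<rho>s xs = (\<lambda>\<beta>. if multilinear_form \<rho>s \<beta> then \<beta> xs else 0)"

definition tensor_space ::
  "('k, 'r::field, 'v::ab_group_add) rep list \<Rightarrow> (('v list \<Rightarrow> 'r) \<Rightarrow> 'r) set" where
  "tensor_space \<rho>s = Modules.module.span (\<lambda>a \<theta> \<beta>. a * \<theta> \<beta>) (pure_tensor \<rho>s ` tuples \<rho>s)"

text \<open>The action of \<open>(g\<^sub>1, \<dots>, g\<^sub>r)\<close> sending the pure tensor of \<open>xs\<close> to the one of
  \<open>(g\<^sub>1 x\<^sub>1, \<dots>, g\<^sub>r x\<^sub>r)\<close>.\<close>

definition tensor_act ::
  "('k, 'r::field, 'v::ab_group_add) rep list \<Rightarrow> 'k mat list \<Rightarrow>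
   (('v list \<Rightarrow> 'r) \<Rightarrow> 'r) \<Rightarrow> ('v list \<Rightarrow> 'r) \<Rightarrow> 'r" where
  "tensor_act \<rho>s gs \<theta> = (\<lambda>\<beta>. if multilinear_form \<rho>s \<beta>
     then \<theta> (\<lambda>xs. \<beta> (map (\<lambda>t. ract (\<rho>s ! t) (gs ! t) (xs ! t)) [0..<length \<rho>s])) else 0)"

text \<open>\<open>\<rho>\<^sub>1 \<times> \<dots> \<times> \<rho>\<^sub>r\<close>: functions on the group with \<open>f (p x) = (\<rho>\<^sub>1 \<otimes> \<dots> \<otimes> \<rho>\<^sub>r)(p) (f x)\<close> for \<open>p\<close> in
  the block upper triangular parabolic subgroup, acting through its diagonal blocks; the group
  acts by right translation.\<close>

definition par_ind ::
  "('k::field, 'r::field, 'v::ab_group_add) rep list \<Rightarrow>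
   ('k, 'r, 'k mat \<Rightarrow> ('v list \<Rightarrow> 'r) \<Rightarrow> 'r) rep" where
  "par_ind \<rho>s = (let ns = map rdeg \<rho>s; m = sum_list ns in
     \<lparr>rdeg = m,
      rscale = (\<lambda>a f x \<beta>. a * f x \<beta>),
      rspace = {f. (\<forall>x\<in>GL m. f x \<in> tensor_space \<rho>s) \<and> (\<forall>x. x \<notin> GL m \<longrightarrow> f x = 0) \<and>
                   (\<forall>p\<in>std_parabolic ns. \<forall>x\<in>GL m.
                      f (p * x) = tensor_act \<rho>s (map (\<lambda>t. dblock ns t p) [0..<length ns]) (f x))},
      ract = (\<lambda>g f x. if x \<in> GL m then f (x * g) else 0)\<rparr>)"

section \<open>Gamma factors\<close>

definition additive_character :: "('k::field \<Rightarrow> 'r::field) \<Rightarrow> bool" where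
  "additive_character \<psi> \<longleftrightarrow> (\<forall>x. \<psi> x \<noteq> 0) \<and> (\<forall>x y. \<psi> (x + y) = \<psi> x * \<psi> y)"

text \<open>In the following, \<open>s\<close> is the chosen square root of the cardinality of the finite field.\<close>

definition fourier ::
  "'r::field \<Rightarrow> ('k::{field,finite} \<Rightarrow> 'r) \<Rightarrow> nat \<Rightarrow> ('k mat \<Rightarrow> 'r) \<Rightarrow> 'k mat \<Rightarrow> 'r" where
  "fourier s \<psi> m \<Phi> a =
     inverse (s ^ (m ^ 2)) * (\<Sum>g\<in>carrier_mat m m. \<Phi> g * \<psi> (mtrace (g * a)))"

definition is_gamma ::
  "'r::field \<Rightarrow> ('k::{field,finite} \<Rightarrow> 'r) \<Rightarrow> ('k, 'r, 'v::ab_group_add) rep \<Rightarrow> 'r \<Rightarrow> bool" where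
  "is_gamma s \<psi> \<rho> c \<longleftrightarrow>
     (\<forall>v\<in>rspace \<rho>. \<forall>\<phi>\<in>rspace (dual_rep \<rho>). \<forall>\<Phi>.
        (\<forall>g\<in>carrier_mat (rdeg \<rho>) (rdeg \<rho>). g \<notin> GL (rdeg \<rho>) \<longrightarrow> \<Phi> g = 0) \<longrightarrow>
        (\<Sum>g\<in>GL (rdeg \<rho>). fourier s \<psi> (rdeg \<rho>) \<Phi> g * \<phi> (ract \<rho> (GLinv (rdeg \<rho>) g) v)) =
        c * (\<Sum>g\<in>GL (rdeg \<rho>). \<Phi> g * \<phi> (ract \<rho> g v)))"

definition gamma_factor ::
  "'r::field \<Rightarrow> ('k::{field,finite} \<Rightarrow> 'r) \<Rightarrow> ('k, 'r, 'v::ab_group_add) rep \<Rightarrow> 'r" where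
  "gamma_factor s \<psi> \<rho> = (THE c. is_gamma s \<psi> \<rho> c)"

end

theory Submission
  imports
    Defs
    "Jordan_Normal_Form.Determinant"
    "HOL-Algebra.Sylow"
begin

text \<open>The gamma factor of \<open>\<rho>\<close> is, up to the factor \<open>s ^ - m\<^sup>2\<close>, the scalar by which the Gauss sum
  \<open>\<Sum>g. \<psi> (tr g) \<rho> (g\<inverse>)\<close> acts.  On \<open>\<rho>\<^sub>1 \<times> \<dots> \<times> \<rho>\<^sub>r\<close>, averaging this sum over the unipotent radical \<open>N\<close>
  restricts it to the parabolic subgroup, where it becomes \<open>\<bar>N\<bar>\<close> times the product of the Gauss sums of
  the \<open>\<rho>\<^sub>i\<close>; so gamma factors are multiplicative, and they pass to subquotients.  The trivial
  character has Gauss sum \<open>- 1\<close>.  For a cuspidal \<open>\<sigma> \<noteq> 1\<close> the Gauss sums of \<open>\<sigma>\<close> and of its dual multiply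
  to \<open>\<Sum>t. \<Sum>g. \<psi> (tr (g (1 - t))) \<sigma> t\<close>.  Singular \<open>g\<close> may be added to the inner sum, as they contribute
  zero by cuspidality, and Fourier inversion on the full matrix ring leaves \<open>q ^ m\<^sup>2\<close>.\<close>

section \<open>The general linear group\<close>

text \<open>The factor of the dual is computed on \<open>\<pi>\<close> itself: the Gauss sum of the
  dual at the inverse character is the transpose of
  \<open>\<Sum>g. inverse (\<psi> (tr g)) \<pi> g\<close>, so the dual of an induced representation
  never has to be described. The sums over g and over its inverse are carried along together by a
  Boolean flag. Two obstacles shape the argument. And \<open>\<pi>'\<close> may be reducible, so
  Schur's lemma is applied to the cuspidal factors, and the scalars of \<open>\<pi>'\<close> and
  \<open>\<pi>\<close> come from induction. The constants come from dimensions: a unipotent radical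
  of dimension d satisfies m^2 = m_1^2 + ... + m_r^2 + 2 d, so its order q^d = s^(2 d) is absorbed
  by the normalisation. A trivial factor has m_i = 1 and contributes - 1 / s. Its two Gauss sums
  multiply to 1 instead of q, which is why each copy costs a factor q in the product.\<close>

lemma GL_iff: "g \<in> GL m \<longleftrightarrow> g \<in> carrier_mat m m \<and> det (g :: 'k::field mat) \<noteq> 0"
proof -
  have "g \<in> Units (ring_mat TYPE('k) m ()) \<Longrightarrow> g \<in> carrier_mat m m"
    unfolding Units_def by (simp add: ring_mat_simps)
  then show ?thesis
    using det_non_zero_imp_unit[of g m "()"] unit_imp_det_non_zero[of g m "()"]
    by (auto simp: GLgroup_def units_of_carrier)
qed

lemma GL_carrier [intro, simp]: "g \<in> GL m \<Longrightarrow> (g :: 'k::field mat) \<in> carrier_mat m m"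
  by (simp add: GL_iff)

lemma mult_GLgroup [simp]: "mult (GLgroup m) = ((*) :: 'k::field mat \<Rightarrow> _)"
  by (simp add: GLgroup_def units_of_mult ring_mat_simps)

lemma one_GLgroup [simp]: "one (GLgroup m) = (1\<^sub>m m :: 'k::field mat)"
  by (simp add: GLgroup_def units_of_one ring_mat_simps)

interpretation GLgroup: group "GLgroup m :: 'k::field mat monoid" for m
  unfolding GLgroup_def
  by (rule monoid.units_group) (rule ring.is_monoid, rule ring_mat)

lemmas GL_mult [simp, intro] = GLgroup.m_closed[simplified]
lemmas GL_one [simp, intro] = GLgroup.one_closed[simplified]
lemmas GLinv_closed [simp, intro] = GLgroup.inv_closed
lemmas GLinv_left [simp] = GLgroup.l_inv[simplified]
lemmas GLinv_right [simp] = GLgroup.r_inv[simplified]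
lemmas GL_assoc = GLgroup.m_assoc[simplified]
lemmas GLinv_mult = GLgroup.inv_mult_group[simplified]

lemma GL_left_one [simp]: "g \<in> GL m \<Longrightarrow> 1\<^sub>m m * g = (g :: 'k::field mat)"
  and GL_right_one [simp]: "g \<in> GL m \<Longrightarrow> g * 1\<^sub>m m = g"
  using left_mult_one_mat[OF GL_carrier] right_mult_one_mat[OF GL_carrier] by auto

lemma GLinv_one [simp]: "GLinv m (1\<^sub>m m) = (1\<^sub>m m :: 'k::field mat)"
  using GLgroup.inv_one[of m] by simp

text \<open>Determinants make a one-sided inverse two-sided, so an inverse found blockwise or by
  counting can be used at once.\<close>

lemma GL_right_inverse:
  fixes A :: "'k::field mat"
  assumes "A \<in> carrier_mat m m" "B \<in> carrier_mat m m" "A * B = 1\<^sub>m m"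
  shows "A \<in> GL m" "B \<in> GL m" "GLinv m A = B"
proof -
  have "det A * det B = 1"
    using det_mult[OF assms(1,2)] assms(3) by simp
  then show AB: "A \<in> GL m" "B \<in> GL m"
    using assms by (auto simp: GL_iff simp del: GL_carrier)
  show "GLinv m A = B"
    by (rule GLgroup.inv_equality) (use mat_mult_left_right_inverse[OF assms] AB in simp_all)
qed

text \<open>A coordinate subspace of the matrix ring. All positions give the full ring; the
  positions above the diagonal blocks give the matrices n for which 1 + n is unipotent. Both uses of
  character orthogonality are sums over such a subspace.\<close>

definition mats_on :: "nat \<Rightarrow> (nat \<times> nat) set \<Rightarrow> 'k::field mat set" where
  "mats_on m S = {A \<in> carrier_mat m m. \<forall>i<m. \<forall>j<m. (i, j) \<notin> S \<longrightarrow> A $$ (i, j) = 0}"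

lemma mats_on_PiE:
  assumes "S \<subseteq> {..<m} \<times> {..<m}"
  shows "bij_betw (\<lambda>f. mat m m (\<lambda>x. if x \<in> S then f x else 0))
    (S \<rightarrow>\<^sub>E (UNIV :: 'k::field set)) (mats_on m S)"
proof (rule bij_betw_byWitness[where f' = "\<lambda>A. restrict (\<lambda>x. A $$ x) S"], goal_cases)
  case 1
  then show ?case using assms by (auto simp: PiE_def extensional_def fun_eq_iff restrict_def)
next
  case 2
  then show ?case using assms by (auto simp: mats_on_def intro!: eq_matI)
next
  case 3
  then show ?case using assms by (auto simp: mats_on_def)
next
  case 4
  then show ?case by auto
qed

lemma
  assumes "S \<subseteq> {..<m} \<times> {..<m}"
  shows finite_mats_on: "finite (mats_on m S :: 'k::{field,finite} mat set)"
    and card_mats_on: "card (mats_on m S :: 'k mat set) = CARD('k) ^ card S"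
proof -
  have S: "finite S" using assms finite_subset by blast
  then have "finite (S \<rightarrow>\<^sub>E (UNIV :: 'k set))" by (intro finite_PiE) auto
  then show "finite (mats_on m S :: 'k mat set)"
    using bij_betw_finite[OF mats_on_PiE[OF assms, where 'k='k]] by simp
  show "card (mats_on m S :: 'k mat set) = CARD('k) ^ card S"
    using bij_betw_same_card[OF mats_on_PiE[OF assms, where 'k='k]] S
    by (simp add: card_funcsetE)
qed

lemma mats_on_full: "mats_on m ({..<m} \<times> {..<m}) = carrier_mat m m"
  by (auto simp: mats_on_def)

lemma finite_carrier_mat [simp]: "finite (carrier_mat m m :: 'k::{field,finite} mat set)"
  using finite_mats_on[of "{..<m} \<times> {..<m}" m] by (simp add: mats_on_full)

lemma finite_GL [simp]: "finite (GL m :: 'k::{field,finite} mat set)"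
  by (rule finite_subset[OF _ finite_carrier_mat[of m]]) auto

lemma
  fixes F :: "'k::{field,finite} mat \<Rightarrow> 'a::comm_monoid_add"
  assumes "h \<in> GL m"
  shows sum_GL_left: "(\<Sum>g\<in>GL m. F (h * g)) = (\<Sum>g\<in>GL m. F g)"
    and sum_GL_right: "(\<Sum>g\<in>GL m. F (g * h)) = (\<Sum>g\<in>GL m. F g)"
proof -
  have *: "GLinv m h * (h * g) = g" "h * (GLinv m h * g) = g"
    "(g * h) * GLinv m h = g" "(g * GLinv m h) * h = g" if "g \<in> GL m" for g
    using GLgroup.inv_solve_left[of h m] GL_assoc[of "GLinv m h" m h g] GL_assoc[of h m "GLinv m h" g]
      GL_assoc[of g m h "GLinv m h"] GL_assoc[of g m "GLinv m h" h] assms that by auto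
  show "(\<Sum>g\<in>GL m. F (h * g)) = (\<Sum>g\<in>GL m. F g)"
    by (rule sum.reindex_bij_witness[of _ "\<lambda>g. GLinv m h * g" "\<lambda>g. h * g"]) (use assms * in auto)
  show "(\<Sum>g\<in>GL m. F (g * h)) = (\<Sum>g\<in>GL m. F g)"
    by (rule sum.reindex_bij_witness[of _ "\<lambda>g. g * GLinv m h" "\<lambda>g. g * h"]) (use assms * in auto)
qed

section \<open>Character sums\<close>

lemma mtrace_altdef:
  assumes "A \<in> carrier_mat m m"
  shows "mtrace A = (\<Sum>i<m. A $$ (i, i))"
  using assms by (simp add: mtrace_def)

lemma mtrace_mult:
  assumes "A \<in> carrier_mat m m" "B \<in> carrier_mat m m"
  shows "mtrace (A * B) = (\<Sum>i<m. \<Sum>j<m. A $$ (i, j) * B $$ (j, i))"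
  using assms
  by (auto simp: mtrace_altdef[OF mult_carrier_mat[OF assms]] scalar_prod_def lessThan_atLeast0 intro!: sum.cong)

lemma mtrace_comm:
  fixes A B :: "'k::field mat"
  assumes "A \<in> carrier_mat m m" "B \<in> carrier_mat m m"
  shows "mtrace (A * B) = mtrace (B * A)"
  unfolding mtrace_mult[OF assms] mtrace_mult[OF assms(2,1)]
  by (subst sum.swap) (simp add: mult.commute)

lemma mtrace_add:
  assumes "A \<in> carrier_mat m m" "B \<in> carrier_mat m m"
  shows "mtrace (A + B) = mtrace A + mtrace B"
  using assms by (simp add: mtrace_altdef[where m=m] sum.distrib)

lemma mtrace_GLinv_conj:
  fixes A :: "'k::field mat"
  assumes "A \<in> carrier_mat m m" "h \<in> GL m"
  shows "mtrace (h * A * GLinv m h) = mtrace A"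
proof -
  have h: "h \<in> carrier_mat m m" "GLinv m h \<in> carrier_mat m m" using assms by auto
  have "mtrace (h * A * GLinv m h) = mtrace (GLinv m h * (h * A))"
    by (rule mtrace_comm[where m=m]) (use h assms(1) in auto)
  also have "GLinv m h * (h * A) = (GLinv m h * h) * A" using assoc_mult_mat[OF h(2,1) assms(1)] by simp
  also have "\<dots> = A" using assms left_mult_one_mat[OF assms(1)] by simp
  finally show ?thesis .
qed

section \<open>Additive characters and their orthogonality on spaces of matrices\<close>

lemma additive_character_zero:
  assumes "additive_character \<chi>" shows "\<chi> 0 = 1"
proof -
  have "\<chi> (0 + 0) = \<chi> 0 * \<chi> 0" "\<chi> 0 \<noteq> 0" using assms unfolding additive_character_def by blast+
  then show ?thesis by simp
qed

lemma additive_character_add: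
  "additive_character \<chi> \<Longrightarrow> \<chi> (x + y) = \<chi> x * \<chi> y"
  unfolding additive_character_def by blast

lemma additive_character_sum:
  assumes "additive_character \<chi>"
  shows "\<chi> (\<Sum>i\<in>I. f i) = (\<Prod>i\<in>I. \<chi> (f i))"
  by (induction I rule: infinite_finite_induct)
    (auto simp: additive_character_zero[OF assms] additive_character_add[OF assms])

lemma additive_character_inverse:
  assumes "additive_character \<chi>"
  shows "additive_character (\<lambda>x. inverse (\<chi> x))"
  using assms unfolding additive_character_def by (simp add: inverse_mult_distrib)

text \<open>The map taking B to \<chi> (tr (B A)) is a character of the additive group
  \<open>mats_on m S\<close>. The trace pairs the entry of B at (i, j) with the entry of A at (j,
  i), so triviality is a condition on A at the transposed positions.\<close>

lemma mats_on_character_sum: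
  fixes \<chi> :: "'k::{field,finite} \<Rightarrow> 'r::field"
  assumes \<chi>: "additive_character \<chi>" "\<exists>x. \<chi> x \<noteq> 1"
    and S: "S \<subseteq> {..<m} \<times> {..<m}" and A: "A \<in> carrier_mat m m"
  shows "(\<Sum>B\<in>mats_on m S. \<chi> (mtrace (B * A))) =
    (if \<forall>(i, j)\<in>S. A $$ (j, i) = 0 then of_nat (CARD('k)) ^ card S else 0)"
proof (cases "\<forall>(i, j)\<in>S. A $$ (j, i) = 0")
  case True
  have "mtrace (B * A) = 0" if "B \<in> mats_on m S" for B
  proof -
    have "B $$ (i, j) * A $$ (j, i) = 0" if "i < m" "j < m" for i j
      using that True \<open>B \<in> _\<close> by (cases "(i, j) \<in> S") (auto simp: mats_on_def)
    moreover have "B \<in> carrier_mat m m" using that by (simp add: mats_on_def)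
    ultimately show ?thesis using A by (simp add: mtrace_mult[where m=m] del: mult_eq_0_iff)
  qed
  then have "(\<Sum>B\<in>mats_on m S. \<chi> (mtrace (B * A))) = (\<Sum>B\<in>(mats_on m S :: 'k mat set). 1)"
    by (intro sum.cong) (auto simp: additive_character_zero[OF \<chi>(1)])
  also have "\<dots> = of_nat (CARD('k)) ^ card S" by (simp add: card_mats_on[OF S])
  finally show ?thesis using True by auto
next
  case False
  then obtain i j where ij: "(i, j) \<in> S" "A $$ (j, i) \<noteq> 0" by auto
  then have ijm: "i < m" "j < m" using S by auto
  obtain x where x: "\<chi> x \<noteq> 1" using \<chi> by blast
  \<comment> \<open>A multiple of an elementary matrix, scaled so that tr (D A) = x; translating by
    it multiplies the sum by \<chi> x, which is not 1.\<close>
  define D where "D = mat m m (\<lambda>p. if p = (i, j) then x / A $$ (j, i) else 0)"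
  have D: "D \<in> carrier_mat m m" by (simp add: D_def)
  have trD: "mtrace (D * A) = x"
  proof -
    have "mtrace (D * A) = (\<Sum>a<m. \<Sum>b<m. if a = i \<and> b = j then x else 0)"
      unfolding mtrace_mult[OF D A] by (intro sum.cong) (use ij in \<open>auto simp: D_def\<close>)
    also have "\<dots> = (\<Sum>a<m. if a = i then x else 0)"
      using ijm by (intro sum.cong) (auto simp: sum.delta)
    finally show ?thesis using ijm by (simp add: sum.delta)
  qed
  have "(\<Sum>B\<in>mats_on m S. \<chi> (mtrace (B * A))) = (\<Sum>B\<in>mats_on m S. \<chi> (mtrace ((D + B) * A)))"
  proof (rule sum.reindex_bij_witness[of _ "\<lambda>B. D + B" "\<lambda>B. B - D"], goal_cases)
    case (1 B) then show ?case using D by (auto simp: mats_on_def intro!: eq_matI)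
  next
    case (2 B) then show ?case using ij D by (auto simp: mats_on_def D_def)
  next
    case (3 B) then show ?case using D by (auto simp: mats_on_def intro!: eq_matI)
  next
    case (4 B) then show ?case using ij D by (auto simp: mats_on_def D_def)
  next
    case (5 B)
    have "D + (B - D) = B" using D 5 by (auto simp: mats_on_def intro!: eq_matI)
    then show ?case by simp
  qed
  also have "\<dots> = (\<Sum>B\<in>mats_on m S. \<chi> x * \<chi> (mtrace (B * A)))"
  proof (intro sum.cong refl)
    fix B :: "'k mat" assume "B \<in> mats_on m S"
    then have B: "B \<in> carrier_mat m m" by (simp add: mats_on_def)
    have "mtrace ((D + B) * A) = mtrace (D * A) + mtrace (B * A)"
      using D B A by (simp add: add_mult_distrib_mat mtrace_add[where m=m])
    then show "\<chi> (mtrace ((D + B) * A)) = \<chi> x * \<chi> (mtrace (B * A))"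
      by (simp add: trD additive_character_add[OF \<chi>(1)])
  qed
  finally have "(\<Sum>B\<in>mats_on m S. \<chi> (mtrace (B * A))) = \<chi> x * (\<Sum>B\<in>mats_on m S. \<chi> (mtrace (B * A)))"
    unfolding sum_distrib_left .
  then have "(\<Sum>B\<in>mats_on m S. \<chi> (mtrace (B * A))) = 0" using x by simp
  then show ?thesis unfolding if_not_P[OF False] .
qed

section \<open>Block upper triangular matrices\<close>

lemma offset_0 [simp]: "offset ns 0 = 0"
  by (simp add: offset_def)

lemma offset_Suc: "t < length ns \<Longrightarrow> offset ns (Suc t) = offset ns t + ns ! t"
  by (simp add: offset_def take_Suc_conv_app_nth)

lemma offset_length [simp]: "offset ns (length ns) = sum_list ns"
  by (simp add: offset_def)

lemma offset_append [simp]: "t \<le> length ns \<Longrightarrow> offset (ns @ ms) t = offset ns t"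
  by (simp add: offset_def)

lemma offset_mono: "t \<le> t' \<Longrightarrow> offset ns t \<le> offset ns t'"
  using sum_list_append[of "take t ns" "take (t' - t) (drop t ns)"]
  by (auto simp: offset_def simp flip: take_add)

lemma offset_le: "offset ns t \<le> sum_list ns"
  by (metis append_take_drop_id le_add1 offset_def sum_list_append)

lemma block_less_offset:
  assumes "t < t'" "t' \<le> length ns" "i < ns ! t"
  shows "offset ns t + i < offset ns t'"
  using offset_mono[of "Suc t" t' ns] offset_Suc[of t ns] assms by simp

lemma block_less:
  assumes "t < length ns" "i < ns ! t"
  shows "offset ns t + i < sum_list ns"
  using block_less_offset[of t "length ns" ns i] assms by simp

lemma block_index:
  assumes "i < sum_list ns"
  obtains t j where "t < length ns" "j < ns ! t" "i = offset ns t + j"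
proof -
  have "\<exists>t<length ns. \<exists>j<ns ! t. i = offset ns t + j"
    using assms
  proof (induction ns arbitrary: i rule: rev_induct)
    case (snoc n ns)
    show ?case
    proof (cases "i < sum_list ns")
      case True
      then obtain t j where "t < length ns" "j < ns ! t" "i = offset ns t + j"
        using snoc.IH by blast
      then show ?thesis by (intro exI[of _ t]) (auto simp: nth_append)
    next
      case False
      then show ?thesis using snoc.prems
        by (intro exI[of _ "length ns"]) (auto intro!: exI[of _ "i - sum_list ns"])
    qed
  qed simp
  then show thesis using that by blast
qed

lemma sum_blocks:
  "(\<Sum>i<sum_list ns. F i) = (\<Sum>t<length ns. \<Sum>i<ns ! t. F (offset ns t + i))"
proof (induction ns rule: rev_induct)
  case (snoc n ns)
  have "(\<Sum>i<a + b. F i) = (\<Sum>i<a. F i) + (\<Sum>i<b. F (a + i))" for a b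
    by (induction b) (auto simp: add.assoc)
  moreover have "(\<Sum>t<length ns. \<Sum>i<(ns @ [n]) ! t. F (offset ns t + i)) =
      (\<Sum>t<length ns. \<Sum>i<ns ! t. F (offset ns t + i))"
    by (intro sum.cong) (auto simp: nth_append)
  ultimately show ?case using snoc by simp
qed simp

text \<open>A block boundary separates the row from the column. Described in this way, the set is
  the transpose of the positions where \<open>std_parabolic\<close> demands zeros, which is how the
  character sum over \<open>mats_on\<close> will produce the parabolic subgroup.\<close>

definition upper_pairs :: "nat list \<Rightarrow> (nat \<times> nat) set" where
  "upper_pairs ns = {(i, j). i < sum_list ns \<and> j < sum_list ns \<and>
     (\<exists>t<length ns. i < offset ns t \<and> offset ns t \<le> j)}"

lemma upper_pairs_subset: "upper_pairs ns \<subseteq> {..<sum_list ns} \<times> {..<sum_list ns}"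
  by (auto simp: upper_pairs_def)

lemma upper_pairs_blocks:
  assumes "t < length ns" "i < ns ! t" "t' < length ns" "j < ns ! t'"
  shows "(offset ns t + i, offset ns t' + j) \<in> upper_pairs ns \<longleftrightarrow> t < t'"
proof
  assume "(offset ns t + i, offset ns t' + j) \<in> upper_pairs ns"
  then obtain r where r: "r < length ns" "offset ns t + i < offset ns r" "offset ns r \<le> offset ns t' + j"
    by (auto simp: upper_pairs_def)
  have "t < r" using r(2) offset_mono[of r t ns] by (metis leI le_add1 le_trans not_le)
  moreover have "r \<le> t'" using r(1,3) block_less_offset[of t' r ns j] assms by (meson leD le_less_linear less_imp_le)
  ultimately show "t < t'" by simp
next
  assume "t < t'"
  then show "(offset ns t + i, offset ns t' + j) \<in> upper_pairs ns"
    using assms block_less[of t ns i] block_less[of t' ns j] block_less_offset[of t t' ns i]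
    by (auto simp: upper_pairs_def intro!: exI[of _ t'])
qed

text \<open>A new last block of size n adds a rectangle of \<open>sum_list ns\<close> by n
  positions, the mixed term of the square. The cardinality is the dimension of the unipotent
  radical, and this identity makes its order cancel against the normalisation of gamma
  factors.\<close>

lemma card_upper_pairs:
  "(sum_list ns)\<^sup>2 = (\<Sum>t<length ns. (ns ! t)\<^sup>2) + 2 * card (upper_pairs ns)"
proof (induction ns rule: rev_induct)
  case Nil
  then show ?case by (simp add: upper_pairs_def)
next
  case (snoc n ns)
  let ?B = "{..<sum_list ns} \<times> {sum_list ns..<sum_list ns + n}"
  have eq: "upper_pairs (ns @ [n]) = upper_pairs ns \<union> ?B"
  proof (intro Set.set_eqI)
    fix x
    show "x \<in> upper_pairs (ns @ [n]) \<longleftrightarrow> x \<in> upper_pairs ns \<union> ?B"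
      by (cases x) (auto simp: upper_pairs_def less_Suc_eq dest: order.strict_trans2[OF _ offset_le])
  qed
  have "finite (upper_pairs ns)" using upper_pairs_subset finite_subset by blast
  moreover have "upper_pairs ns \<inter> ?B = {}" by (auto simp: upper_pairs_def)
  ultimately have "card (upper_pairs (ns @ [n])) = card (upper_pairs ns) + sum_list ns * n"
    unfolding eq by (subst card_Un_disjoint) auto
  moreover have "(\<Sum>t<length ns. ((ns @ [n]) ! t)\<^sup>2) = (\<Sum>t<length ns. (ns ! t)\<^sup>2)"
    by (intro sum.cong) (auto simp: nth_append)
  ultimately show ?case using snoc.IH by (simp add: power2_sum)
qed

text \<open>The parabolic subgroup without invertibility: products and candidate inverses can be
  placed here before they are known to be invertible. The condition has the transposed shape
  produced by \<open>mats_on_character_sum\<close>.\<close>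

definition block_upper :: "nat list \<Rightarrow> 'k::field mat set" where
  "block_upper ns = {g \<in> carrier_mat (sum_list ns) (sum_list ns). \<forall>(i, j)\<in>upper_pairs ns. g $$ (j, i) = 0}"

lemma std_parabolic_iff: "p \<in> std_parabolic ns \<longleftrightarrow> p \<in> GL (sum_list ns) \<and> p \<in> block_upper ns"
proof -
  have "(\<forall>t<length ns. \<forall>i<sum_list ns. \<forall>j<sum_list ns.
       offset ns t \<le> i \<and> j < offset ns t \<longrightarrow> p $$ (i, j) = 0) \<longleftrightarrow>
     (\<forall>(i, j)\<in>upper_pairs ns. p $$ (j, i) = 0)"
    unfolding upper_pairs_def by blast
  then show ?thesis
    by (auto simp: std_parabolic_def block_upper_def)
qed

lemma block_upper_zero:
  assumes "p \<in> block_upper ns" "t' < t" "t < length ns" "i < ns ! t" "j < ns ! t'"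
  shows "p $$ (offset ns t + i, offset ns t' + j) = 0"
  using assms upper_pairs_blocks[of t' ns j t i] by (auto simp: block_upper_def)

lemma block_upperI:
  assumes "p \<in> carrier_mat (sum_list ns) (sum_list ns)"
    "\<And>t t' i j. t' < t \<Longrightarrow> t < length ns \<Longrightarrow> i < ns ! t \<Longrightarrow> j < ns ! t' \<Longrightarrow>
       p $$ (offset ns t + i, offset ns t' + j) = 0"
  shows "p \<in> block_upper ns"
proof -
  have "p $$ (b, a) = 0" if ab: "(a, b) \<in> upper_pairs ns" for a b
  proof -
    have "a < sum_list ns" "b < sum_list ns" using ab by (auto simp: upper_pairs_def)
    then obtain t i t' j where "t < length ns" "i < ns ! t" "b = offset ns t + i"
      "t' < length ns" "j < ns ! t'" "a = offset ns t' + j"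
      by (metis block_index)
    then show ?thesis using ab upper_pairs_blocks[of t' ns j t i] assms(2) by simp
  qed
  then show ?thesis using assms(1) by (auto simp: block_upper_def)
qed

lemma block_entry_mult:
  fixes p q :: "'k::field mat"
  assumes "p \<in> carrier_mat (sum_list ns) (sum_list ns)" "q \<in> carrier_mat (sum_list ns) (sum_list ns)"
    "t < length ns" "i < ns ! t" "t' < length ns" "j < ns ! t'"
  shows "(p * q) $$ (offset ns t + i, offset ns t' + j) =
    (\<Sum>r<length ns. \<Sum>k<ns ! r. p $$ (offset ns t + i, offset ns r + k) * q $$ (offset ns r + k, offset ns t' + j))"
proof -
  have "(p * q) $$ (offset ns t + i, offset ns t' + j) =
      (\<Sum>k<sum_list ns. p $$ (offset ns t + i, k) * q $$ (k, offset ns t' + j))"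
    using assms block_less[of t ns i] block_less[of t' ns j]
    by (auto simp: scalar_prod_def lessThan_atLeast0 intro!: sum.cong)
  then show ?thesis by (simp add: sum_blocks)
qed

lemma block_upper_mult:
  assumes "p \<in> block_upper ns" "q \<in> block_upper ns"
  shows "p * q \<in> block_upper ns"
proof (rule block_upperI)
  show "p * q \<in> carrier_mat (sum_list ns) (sum_list ns)"
    using assms by (auto simp: block_upper_def)
  fix t t' i j assume t: "t' < t" "t < length ns" "i < ns ! t" "j < ns ! t'"
  have "p $$ (offset ns t + i, offset ns r + k) * q $$ (offset ns r + k, offset ns t' + j) = 0"
    if "r < length ns" "k < ns ! r" for r k
    using block_upper_zero[OF assms(1), of r t i k] block_upper_zero[OF assms(2), of t' r k j] t that
    by (cases "r < t") auto
  then show "(p * q) $$ (offset ns t + i, offset ns t' + j) = 0"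
    using assms t by (subst block_entry_mult) (auto simp: block_upper_def intro!: sum.neutral)
qed

section \<open>Diagonal blocks as homomorphisms, and inverses of block triangular matrices\<close>

lemma dblock_carrier [simp]: "dblock ns t p \<in> carrier_mat (ns ! t) (ns ! t)"
  by (simp add: dblock_def)

text \<open>In the expansion over intermediate blocks \<open>r\<close>, the entries of
  \<open>p\<close> vanish for \<open>r < t\<close> and those of \<open>q\<close> for
  \<open>r > t\<close>, which leaves \<open>r = t\<close>.\<close>

lemma dblock_mult:
  fixes p q :: "'k::field mat"
  assumes "p \<in> block_upper ns" "q \<in> block_upper ns" "t < length ns"
  shows "dblock ns t (p * q) = dblock ns t p * dblock ns t q"
proof (rule eq_matI)
  fix i j assume "i < dim_row (dblock ns t p * dblock ns t q)" "j < dim_col (dblock ns t p * dblock ns t q)"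
  then have ij: "i < ns ! t" "j < ns ! t" by (auto simp: dblock_def)
  let ?F = "\<lambda>r k. p $$ (offset ns t + i, offset ns r + k) * q $$ (offset ns r + k, offset ns t + j)"
  have "(\<Sum>k<ns ! r. ?F r k) = 0" if "r < length ns" "r \<noteq> t" for r
    using block_upper_zero[OF assms(1), of r t i] block_upper_zero[OF assms(2), of t r _ j] ij that assms(3)
    by (intro sum.neutral ballI) (cases "r < t", auto)
  then have "(\<Sum>r<length ns. \<Sum>k<ns ! r. ?F r k) = (\<Sum>r\<in>{t}. \<Sum>k<ns ! r. ?F r k)"
    using assms(3) by (intro sum.mono_neutral_right) auto
  moreover have "dblock ns t (p * q) $$ (i, j) = (\<Sum>r<length ns. \<Sum>k<ns ! r. ?F r k)"
    using block_entry_mult[of p ns q t i t j] assms ij by (auto simp: block_upper_def dblock_def)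
  moreover have "(dblock ns t p * dblock ns t q) $$ (i, j) = (\<Sum>k<ns ! t. ?F t k)"
    using ij by (auto simp: dblock_def scalar_prod_def lessThan_atLeast0 intro!: sum.cong)
  ultimately show "dblock ns t (p * q) $$ (i, j) = (dblock ns t p * dblock ns t q) $$ (i, j)"
    by simp
qed (auto simp: dblock_def)

lemma block_upper_one: "(1\<^sub>m (sum_list ns) :: 'k::field mat) \<in> block_upper ns"
  by (auto simp: block_upper_def upper_pairs_def)

lemma dblock_one:
  assumes "t < length ns"
  shows "dblock ns t (1\<^sub>m (sum_list ns) :: 'k::field mat) = 1\<^sub>m (ns ! t)"
  using block_less[OF assms] by (auto simp: dblock_def intro!: eq_matI)

text \<open>Multiplication by \<open>p\<close> is injective on the finite set of block upper triangular matrices,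
  hence surjective.\<close>

lemma GLinv_block_upper:
  fixes p :: "'k::{field,finite} mat"
  assumes "p \<in> std_parabolic ns"
  shows "GLinv (sum_list ns) p \<in> block_upper ns"
proof -
  let ?m = "sum_list ns"
  have p: "p \<in> GL ?m" "p \<in> block_upper ns" using assms by (auto simp: std_parabolic_iff)
  have fin: "finite (block_upper ns :: 'k mat set)"
    by (rule finite_subset[OF _ finite_carrier_mat[of ?m]]) (auto simp: block_upper_def)
  have "inj_on ((*) p) (block_upper ns)"
  proof (rule inj_onI)
    fix x y assume xy: "x \<in> block_upper ns" "y \<in> block_upper ns" "p * x = p * y"
    have "z = GLinv ?m p * (p * z)" if "z \<in> block_upper ns" for z
    proof -
      have "z \<in> carrier_mat ?m ?m" using that by (simp add: block_upper_def)
      then show ?thesis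
        using assoc_mult_mat[of "GLinv ?m p" ?m ?m p ?m z ?m] p(1) by simp
    qed
    then show "x = y" using xy by metis
  qed
  then have "(*) p ` block_upper ns = block_upper ns"
    using block_upper_mult[OF p(2)] fin by (intro endo_inj_surj) auto
  then obtain x where x: "x \<in> block_upper ns" "p * x = 1\<^sub>m ?m"
    using block_upper_one[of ns, where 'k='k] by (metis imageE)
  then have "GLinv ?m p = x"
    by (intro GL_right_inverse(3)) (use p x in \<open>auto simp: block_upper_def\<close>)
  then show ?thesis using x by simp
qed

lemma
  fixes p :: "'k::{field,finite} mat"
  assumes "p \<in> std_parabolic ns" "t < length ns"
  shows dblock_GL: "dblock ns t p \<in> GL (ns ! t)"
    and dblock_GLinv: "dblock ns t (GLinv (sum_list ns) p) = GLinv (ns ! t) (dblock ns t p)"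
proof -
  have "dblock ns t p * dblock ns t (GLinv (sum_list ns) p) = 1\<^sub>m (ns ! t)"
    using dblock_mult[OF _ GLinv_block_upper, of p ns p t] dblock_one[of t ns, where 'k='k] assms
    by (simp add: std_parabolic_iff)
  from GL_right_inverse[OF dblock_carrier dblock_carrier this]
  show "dblock ns t p \<in> GL (ns ! t)"
    "dblock ns t (GLinv (sum_list ns) p) = GLinv (ns ! t) (dblock ns t p)" by auto
qed

lemma GLinv_std_parabolic:
  fixes p :: "'k::{field,finite} mat"
  assumes "p \<in> std_parabolic ns"
  shows "GLinv (sum_list ns) p \<in> std_parabolic ns"
  using GLinv_block_upper[OF assms] assms by (auto simp: std_parabolic_iff)

text \<open>Unit diagonal blocks make the matrix upper triangular in the ordinary sense with ones on
  the diagonal, so its determinant is 1.\<close>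

lemma unipotent_block_GL:
  fixes p :: "'k::field mat"
  assumes "p \<in> block_upper ns" "\<And>t. t < length ns \<Longrightarrow> dblock ns t p = 1\<^sub>m (ns ! t)"
  shows "p \<in> GL (sum_list ns)"
proof -
  have p: "p \<in> carrier_mat (sum_list ns) (sum_list ns)" using assms by (simp add: block_upper_def)
  have entry: "p $$ (offset ns t + i, offset ns t + j) = (if i = j then 1 else 0)"
    if "t < length ns" "i < ns ! t" "j < ns ! t" for t i j
    using arg_cong[OF assms(2)[OF that(1)], of "\<lambda>A. A $$ (i, j)"] that by (simp add: dblock_def)
  have "p $$ (a, b) = 0" if ab: "b < a" "a < sum_list ns" for a b
  proof -
    have "b < sum_list ns" using ab by simp
    then obtain t i t' j where *: "t < length ns" "i < ns ! t" "a = offset ns t + i"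
      "t' < length ns" "j < ns ! t'" "b = offset ns t' + j"
      using block_index[OF ab(2)] block_index[of b ns] by metis
    consider "t' < t" | "t' = t" | "t < t'" by linarith
    then show ?thesis
    proof cases
      case 3
      then show ?thesis using block_less_offset[of t t' ns i] * ab by simp
    qed (use * ab block_upper_zero[OF assms(1)] entry in auto)
  qed
  moreover have diag: "p $$ (a, a) = 1" if "a < sum_list ns" for a
    using block_index[OF that] entry by metis
  ultimately have "upper_triangular p" using p by (auto simp: upper_triangular_def)
  then have "det p = prod_list (diag_mat p)" using p by (rule det_upper_triangular)
  also have "diag_mat p = map (\<lambda>_. 1) [0..<sum_list ns]"
    unfolding diag_mat_def using p by (auto simp: diag)
  also have "prod_list \<dots> = (1::'k)" by (simp add: map_replicate_const)
  finally show ?thesis using p by (simp add: GL_iff del: GL_carrier)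
qed

section \<open>Summation over a parabolic subgroup\<close>

text \<open>A right inverse of taking diagonal blocks. The blocks are disjoint, so at most one
  summand is nonzero, and the sum spares choosing the block to which an index belongs.\<close>

definition block_diag :: "nat list \<Rightarrow> 'k::field mat list \<Rightarrow> 'k mat" where
  "block_diag ns gs = mat (sum_list ns) (sum_list ns) (\<lambda>(a, b). \<Sum>t<length ns.
     if offset ns t \<le> a \<and> a < offset ns (Suc t) \<and> offset ns t \<le> b \<and> b < offset ns (Suc t)
     then gs ! t $$ (a - offset ns t, b - offset ns t) else 0)"

lemma in_block_iff:
  assumes "t < length ns" "t' < length ns" "i < ns ! t'"
  shows "offset ns t \<le> offset ns t' + i \<and> offset ns t' + i < offset ns (Suc t) \<longleftrightarrow> t = t'"
proof
  assume a: "offset ns t \<le> offset ns t' + i \<and> offset ns t' + i < offset ns (Suc t)"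
  have "\<not> t' < t" using a block_less_offset[of t' t ns i] assms by auto
  moreover have "\<not> t < t'" using a offset_mono[of "Suc t" t' ns] by auto
  ultimately show "t = t'" by simp
qed (use assms in \<open>auto simp: offset_Suc\<close>)

lemma block_diag_entry:
  assumes "t < length ns" "i < ns ! t" "t' < length ns" "j < ns ! t'"
  shows "block_diag ns gs $$ (offset ns t + i, offset ns t' + j) = (if t = t' then gs ! t $$ (i, j) else 0)"
proof -
  let ?a = "offset ns t + i" and ?b = "offset ns t' + j"
  have "(if offset ns r \<le> ?a \<and> ?a < offset ns (Suc r) \<and> offset ns r \<le> ?b \<and> ?b < offset ns (Suc r)
      then gs ! r $$ (?a - offset ns r, ?b - offset ns r) else 0) =
    (if r = t then if t = t' then gs ! t $$ (i, j) else 0 else 0)" if "r < length ns" for r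
    using in_block_iff[OF that assms(1,2)] in_block_iff[OF that assms(3,4)] by auto
  then have "(\<Sum>r<length ns. if offset ns r \<le> ?a \<and> ?a < offset ns (Suc r) \<and> offset ns r \<le> ?b \<and>
      ?b < offset ns (Suc r) then gs ! r $$ (?a - offset ns r, ?b - offset ns r) else 0) =
      (\<Sum>r<length ns. if r = t then if t = t' then gs ! t $$ (i, j) else 0 else 0)"
    by (intro sum.cong refl) simp
  then have "block_diag ns gs $$ (?a, ?b) =
      (\<Sum>r<length ns. if r = t then if t = t' then gs ! t $$ (i, j) else 0 else 0)"
    unfolding block_diag_def
    by (subst index_mat[OF block_less[OF assms(1,2)] block_less[OF assms(3,4)]]) (simp only: prod.case)
  then show ?thesis using assms by simp
qed

lemma block_diag_upper: "block_diag ns gs \<in> block_upper ns"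
proof (rule block_upperI)
  show "block_diag ns gs \<in> carrier_mat (sum_list ns) (sum_list ns)" by (simp add: block_diag_def)
qed (subst block_diag_entry, auto)

lemma dblock_block_diag:
  assumes "t < length ns" "gs ! t \<in> carrier_mat (ns ! t) (ns ! t)"
  shows "dblock ns t (block_diag ns gs) = gs ! t"
  using assms by (auto intro!: eq_matI simp: dblock_def block_diag_entry)

lemma in_listset_iff:
  "xs \<in> listset As \<longleftrightarrow> length xs = length As \<and> (\<forall>t<length As. xs ! t \<in> As ! t)"
proof (induction As arbitrary: xs)
  case (Cons A As)
  show ?case
    by (cases xs) (auto simp: set_Cons_def Cons.IH All_less_Suc2)
qed auto

lemma finite_listset: "(\<And>A. A \<in> set As \<Longrightarrow> finite A) \<Longrightarrow> finite (listset As)"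
proof (induction As)
  case (Cons A As)
  have "set_Cons A (listset As) = (\<lambda>(x, xs). x # xs) ` (A \<times> listset As)"
    by (auto simp: set_Cons_def)
  then show ?case using Cons by simp
qed simp

abbreviation levi :: "nat list \<Rightarrow> 'k::field mat list set" where
  "levi ns \<equiv> listset (map GL ns)"

lemma in_levi_iff: "gs \<in> levi ns \<longleftrightarrow> length gs = length ns \<and> (\<forall>t<length ns. gs ! t \<in> GL (ns ! t))"
  by (simp add: in_listset_iff cong: conj_cong)

abbreviation dblocks :: "nat list \<Rightarrow> 'k mat \<Rightarrow> 'k mat list" where
  "dblocks ns p \<equiv> map (\<lambda>t. dblock ns t p) [0..<length ns]"

text \<open>Multiplying by the block diagonal matrix of the inverse blocks gives a matrix with unit
  diagonal blocks, which is invertible; the determinant of \<open>p\<close> divides that of the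
  product.\<close>

lemma block_upper_GL:
  fixes p :: "'k::field mat"
  assumes "p \<in> block_upper ns" "\<And>t. t < length ns \<Longrightarrow> dblock ns t p \<in> GL (ns ! t)"
  shows "p \<in> GL (sum_list ns)"
proof -
  let ?m = "sum_list ns"
  let ?q = "block_diag ns (map (\<lambda>t. GLinv (ns ! t) (dblock ns t p)) [0..<length ns])"
  have "p * ?q \<in> GL ?m"
  proof (rule unipotent_block_GL)
    show "p * ?q \<in> block_upper ns" using assms block_diag_upper by (intro block_upper_mult)
    fix t assume "t < length ns"
    then show "dblock ns t (p * ?q) = 1\<^sub>m (ns ! t)"
      using assms by (simp add: dblock_mult block_diag_upper dblock_block_diag)
  qed
  moreover have "p \<in> carrier_mat ?m ?m" "?q \<in> carrier_mat ?m ?m"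
    using assms block_diag_upper by (auto simp: block_upper_def)
  ultimately show ?thesis using det_mult[of p ?m ?q] by (simp add: GL_iff del: GL_carrier)
qed

text \<open>The fibre is the additive translate of \<open>mats_on\<close> at
  \<open>upper_pairs\<close> by \<open>block_diag ns gs\<close>. Using this instead of a coset of
  the unipotent group reduces the count to free matrix entries.\<close>

lemma card_dblocks_fibre:
  fixes gs :: "'k::{field,finite} mat list"
  assumes gs: "gs \<in> levi ns"
  shows "card {p \<in> std_parabolic ns. dblocks ns p = gs} = CARD('k) ^ card (upper_pairs ns)"
proof -
  let ?m = "sum_list ns" and ?d = "block_diag ns gs"
  have len: "length gs = length ns" and G: "\<And>t. t < length ns \<Longrightarrow> gs ! t \<in> GL (ns ! t)"
    using gs by (auto simp: in_levi_iff)
  have d: "?d \<in> carrier_mat ?m ?m" "?d \<in> block_upper ns"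
    using block_diag_upper[of ns gs] by (auto simp: block_upper_def)
  have fib: "p \<in> std_parabolic ns \<and> dblocks ns p = gs \<longleftrightarrow>
      p \<in> carrier_mat ?m ?m \<and> p - ?d \<in> mats_on ?m (upper_pairs ns)" for p
  proof safe
    assume p: "p \<in> std_parabolic ns" and eq: "gs = dblocks ns p"
    show pc: "p \<in> carrier_mat ?m ?m" using p by (simp add: std_parabolic_iff)
    have "p $$ (a, b) = ?d $$ (a, b)" if ab: "a < ?m" "b < ?m" "(a, b) \<notin> upper_pairs ns" for a b
    proof -
      obtain t i t' j where *: "t < length ns" "i < ns ! t" "a = offset ns t + i"
        "t' < length ns" "j < ns ! t'" "b = offset ns t' + j"
        using block_index[OF ab(1)] block_index[OF ab(2)] by metis
      then have "t' \<le> t" using ab upper_pairs_blocks[of t ns i t' j] by auto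
      then show ?thesis
        using * block_upper_zero[of p ns t' t i j] p
        by (cases "t' = t") (auto simp: block_diag_entry eq dblock_def std_parabolic_iff)
    qed
    then show "p - block_diag ns (dblocks ns p) \<in> mats_on ?m (upper_pairs ns)"
      using pc d by (auto simp: mats_on_def eq)
  next
    assume pc: "p \<in> carrier_mat ?m ?m" and diff: "p - ?d \<in> mats_on ?m (upper_pairs ns)"
    have same: "p $$ (a, b) = ?d $$ (a, b)" if "a < ?m" "b < ?m" "(a, b) \<notin> upper_pairs ns" for a b
      using diff that pc d by (auto simp: mats_on_def)
    have same': "p $$ (offset ns t + i, offset ns t' + j) = (if t = t' then gs ! t $$ (i, j) else 0)"
      if "t' \<le> t" "t < length ns" "i < ns ! t" "j < ns ! t'" for t i t' j
      using same[of "offset ns t + i" "offset ns t' + j"] that block_less[of t ns i] block_less[of t' ns j]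
        upper_pairs_blocks[of t ns i t' j] by (simp add: block_diag_entry)
    have db: "dblock ns t p = gs ! t" if "t < length ns" for t
      using same'[of t t] that G[OF that, THEN GL_carrier] by (auto simp: dblock_def intro!: eq_matI)
    have "p \<in> block_upper ns" by (rule block_upperI) (use pc same' in auto)
    then show "p \<in> std_parabolic ns"
      using block_upper_GL[of p ns] db G by (auto simp: std_parabolic_iff)
    show "dblocks ns p = gs" using db len by (auto intro!: nth_equalityI)
  qed
  have "bij_betw (\<lambda>p. p - ?d) {p \<in> std_parabolic ns. dblocks ns p = gs} (mats_on ?m (upper_pairs ns))"
  proof (rule bij_betw_byWitness[where f' = "\<lambda>n. n + ?d"])
    have 1: "p - ?d + ?d = p" "p + ?d - ?d = p" if "p \<in> carrier_mat ?m ?m" for p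
      using that d by (auto intro!: eq_matI)
    show "\<forall>p\<in>{p \<in> std_parabolic ns. dblocks ns p = gs}. p - ?d + ?d = p"
      using 1 by (auto simp: std_parabolic_iff)
    show "\<forall>p\<in>mats_on ?m (upper_pairs ns). p + ?d - ?d = p"
      using 1 by (auto simp: mats_on_def)
    show "(\<lambda>p. p - ?d) ` {p \<in> std_parabolic ns. dblocks ns p = gs} \<subseteq> mats_on ?m (upper_pairs ns)"
      using fib by blast
    show "(\<lambda>n. n + ?d) ` mats_on ?m (upper_pairs ns) \<subseteq> {p \<in> std_parabolic ns. dblocks ns p = gs}"
    proof clarify
      fix n :: "'k mat" assume n: "n \<in> mats_on ?m (upper_pairs ns)"
      then have "n \<in> carrier_mat ?m ?m" by (simp add: mats_on_def)
      then show "n + ?d \<in> std_parabolic ns \<and> dblocks ns (n + ?d) = gs"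
        unfolding fib using n 1 d by simp
    qed
  qed
  from bij_betw_same_card[OF this] show ?thesis
    by (simp add: card_mats_on[OF upper_pairs_subset])
qed

lemma sum_std_parabolic:
  fixes H :: "'k::{field,finite} mat list \<Rightarrow> 'r::field"
  shows "(\<Sum>p\<in>std_parabolic ns. H (dblocks ns p)) =
    of_nat (CARD('k)) ^ card (upper_pairs ns) * (\<Sum>gs\<in>levi ns. H gs)"
proof -
  have fin: "finite (std_parabolic ns :: 'k mat set)"
    by (rule finite_subset[OF _ finite_GL[of "sum_list ns"]]) (auto simp: std_parabolic_def)
  have finl: "finite (levi ns :: 'k mat list set)" by (rule finite_listset) auto
  have "dblocks ns ` std_parabolic ns \<subseteq> (levi ns :: 'k mat list set)"
    by (auto simp: in_levi_iff dblock_GL)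
  from sum.group[OF fin finl this, of "\<lambda>p. H (dblocks ns p)"]
  have "(\<Sum>p\<in>std_parabolic ns. H (dblocks ns p)) =
      (\<Sum>gs\<in>levi ns. \<Sum>p\<in>{p \<in> std_parabolic ns. dblocks ns p = gs}. H (dblocks ns p))" by simp
  also have "\<dots> = (\<Sum>gs\<in>levi ns. of_nat (CARD('k)) ^ card (upper_pairs ns) * H gs)"
  proof (intro sum.cong refl)
    fix gs :: "'k mat list" assume "gs \<in> levi ns"
    from card_dblocks_fibre[OF this]
    show "(\<Sum>p\<in>{p \<in> std_parabolic ns. dblocks ns p = gs}. H (dblocks ns p)) =
        of_nat (CARD('k)) ^ card (upper_pairs ns) * H gs" by simp
  qed
  finally show ?thesis by (simp add: sum_distrib_left)
qed

lemma mtrace_dblocks: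
  assumes "p \<in> carrier_mat (sum_list ns) (sum_list ns)"
  shows "mtrace p = (\<Sum>t<length ns. mtrace (dblock ns t p))"
  unfolding mtrace_altdef[OF assms] sum_blocks
  by (intro sum.cong) (auto simp: mtrace_def dblock_def)

text \<open>Links the two descriptions of the unipotent radical: characters are summed over the
  additive group of the \<open>n\<close>, while invariance is stated for the group elements 1 +
  n.\<close>

lemma one_plus_unipotent:
  fixes n :: "'k::field mat"
  assumes "n \<in> mats_on (sum_list ns) (upper_pairs ns)"
  shows "1\<^sub>m (sum_list ns) + n \<in> std_unipotent ns"
proof -
  let ?m = "sum_list ns" and ?u = "1\<^sub>m (sum_list ns) + n"
  have n: "n \<in> carrier_mat ?m ?m" using assms by (simp add: mats_on_def)
  have entry: "?u $$ (offset ns t + i, offset ns t' + j) = 1\<^sub>m ?m $$ (offset ns t + i, offset ns t' + j)"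
    if "t' \<le> t" "t < length ns" "i < ns ! t" "j < ns ! t'" for t i t' j
    using assms that block_less[of t ns i] block_less[of t' ns j]
      upper_pairs_blocks[of t ns i t' j] n by (auto simp: mats_on_def)
  have up: "?u \<in> block_upper ns"
  proof (rule block_upperI)
    fix t t' i j assume *: "t' < t" "t < length ns" "i < ns ! t" "j < ns ! t'"
    then have "offset ns t' + j < offset ns t + i" using block_less_offset[of t' t ns j] by simp
    then show "?u $$ (offset ns t + i, offset ns t' + j) = 0"
      using entry[of t' t i j] * block_less[of t ns i] by simp
  qed (use n in auto)
  have db: "dblock ns t ?u = 1\<^sub>m (ns ! t)" if "t < length ns" for t
    using entry[of t t] that block_less[OF that] by (auto simp: dblock_def intro!: eq_matI)
  show ?thesis
    using up db unipotent_block_GL[OF up] by (auto simp: std_unipotent_def std_parabolic_iff)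
qed

lemma std_unipotent_GL: "u \<in> std_unipotent ns \<Longrightarrow> u \<in> GL (sum_list ns)"
  by (simp add: std_unipotent_def std_parabolic_def)

text \<open>Averaging over the unipotent radical kills the part of the sum outside the parabolic
  subgroup, by orthogonality of characters.\<close>

lemma sum_GL_parabolic:
  fixes \<chi> :: "'k::{field,finite} \<Rightarrow> 'r::field" and \<phi> :: "'k mat \<Rightarrow> 'r"
  assumes \<chi>: "additive_character \<chi>" "\<exists>x. \<chi> x \<noteq> 1" and q: "of_nat (CARD('k)) \<noteq> (0::'r)"
    and inv: "(\<forall>u\<in>std_unipotent ns. \<forall>g\<in>GL (sum_list ns). \<phi> (u * g) = \<phi> g) \<or>
      (\<forall>u\<in>std_unipotent ns. \<forall>g\<in>GL (sum_list ns). \<phi> (g * u) = \<phi> g)"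
  shows "(\<Sum>g\<in>GL (sum_list ns). \<chi> (mtrace g) * \<phi> g) = (\<Sum>p\<in>std_parabolic ns. \<chi> (mtrace p) * \<phi> p)"
proof -
  let ?m = "sum_list ns" and ?N = "mats_on (sum_list ns) (upper_pairs ns) :: 'k mat set"
  let ?q = "of_nat (CARD('k)) ^ card (upper_pairs ns) :: 'r"
  let ?S = "\<Sum>g\<in>GL ?m. \<chi> (mtrace g) * \<phi> g"
  \<comment> \<open>Replacing g by (1 + n) g or by g (1 + n) multiplies the character value by
    \<chi> (tr (n g)) in both cases, since tr (g n) = tr (n g). Left and right invariance therefore
    lead to the same identity.\<close>
  have translate: "?S = (\<Sum>g\<in>GL ?m. \<chi> (mtrace g) * \<phi> g * \<chi> (mtrace (n * g)))" if "n \<in> ?N" for n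
  proof -
    let ?u = "1\<^sub>m ?m + n"
    have n: "n \<in> carrier_mat ?m ?m" using that by (simp add: mats_on_def)
    have u: "?u \<in> std_unipotent ns" by (rule one_plus_unipotent[OF that])
    have uG: "?u \<in> GL ?m" by (rule std_unipotent_GL[OF u])
    have tr: "mtrace (?u * g) = mtrace g + mtrace (n * g)" "mtrace (g * ?u) = mtrace g + mtrace (n * g)"
      if "g \<in> GL ?m" for g
    proof -
      have g: "g \<in> carrier_mat ?m ?m" using that by simp
      then have "?u * g = g + n * g" using n by (simp add: add_mult_distrib_mat[of _ ?m ?m])
      then show 1: "mtrace (?u * g) = mtrace g + mtrace (n * g)"
        using n g by (simp add: mtrace_add[where m="?m"])
      show "mtrace (g * ?u) = mtrace g + mtrace (n * g)"
        using mtrace_comm[OF g, of ?u] n 1 by simp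
    qed
    from inv show ?thesis
    proof
      assume "\<forall>u\<in>std_unipotent ns. \<forall>g\<in>GL ?m. \<phi> (u * g) = \<phi> g"
      then show ?thesis
        using sum_GL_left[OF uG, of "\<lambda>g. \<chi> (mtrace g) * \<phi> g"] u tr
        by (simp add: additive_character_add[OF \<chi>(1)] mult_ac cong: sum.cong)
    next
      assume "\<forall>u\<in>std_unipotent ns. \<forall>g\<in>GL ?m. \<phi> (g * u) = \<phi> g"
      then show ?thesis
        using sum_GL_right[OF uG, of "\<lambda>g. \<chi> (mtrace g) * \<phi> g"] u tr
        by (simp add: additive_character_add[OF \<chi>(1)] mult_ac cong: sum.cong)
    qed
  qed
  have "?q * ?S = (\<Sum>n\<in>?N. ?S)" by (simp add: card_mats_on[OF upper_pairs_subset])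
  also have "\<dots> = (\<Sum>n\<in>?N. \<Sum>g\<in>GL ?m. \<chi> (mtrace g) * \<phi> g * \<chi> (mtrace (n * g)))"
    by (intro sum.cong refl translate)
  also have "\<dots> = (\<Sum>g\<in>GL ?m. \<chi> (mtrace g) * \<phi> g * (\<Sum>n\<in>?N. \<chi> (mtrace (n * g))))"
    by (subst sum.swap) (simp add: sum_distrib_left)
  \<comment> \<open>By orthogonality the sum over \<open>n\<close> is nonzero exactly when the
    entries of g below the diagonal blocks vanish.\<close>
  also have "\<dots> = (\<Sum>g\<in>GL ?m. if g \<in> std_parabolic ns then ?q * (\<chi> (mtrace g) * \<phi> g) else 0)"
    by (intro sum.cong refl, subst mats_on_character_sum[OF \<chi> upper_pairs_subset])
      (auto simp: std_parabolic_iff block_upper_def mult_ac)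
  also have "\<dots> = (\<Sum>p\<in>std_parabolic ns. ?q * (\<chi> (mtrace p) * \<phi> p))"
    by (rule sum.mono_neutral_cong_right) (auto simp: std_parabolic_def)
  finally have "?q * ?S = ?q * (\<Sum>p\<in>std_parabolic ns. \<chi> (mtrace p) * \<phi> p)"
    by (simp add: sum_distrib_left)
  then show ?thesis using q by simp
qed

section \<open>Gauss sums acting by scalars\<close>

text \<open>\<open>True\<close> is the form of the Gauss sum in the definition of the gamma factor;
  \<open>False\<close> is the form to which the gamma factor of the dual reduces.\<close>

definition gpow :: "bool \<Rightarrow> nat \<Rightarrow> 'k::field mat \<Rightarrow> 'k mat" where
  "gpow b m g = (if b then GLinv m g else g)"

definition gauss_op ::
  "('k::{field,finite} \<Rightarrow> 'r::field) \<Rightarrow> bool \<Rightarrow> ('k, 'r, 'v::ab_group_add) rep \<Rightarrow> 'v \<Rightarrow> 'v" where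
  "gauss_op \<chi> b \<rho> v =
     (\<Sum>g\<in>GL (rdeg \<rho>). rscale \<rho> (\<chi> (mtrace g)) (ract \<rho> (gpow b (rdeg \<rho>) g) v))"

text \<open>A relation, since a reducible representation may have no such scalar. On the zero space
  every \<open>c\<close> qualifies, so a gamma factor also needs the space to be nonzero.\<close>

definition gauss_scalar ::
  "('k::{field,finite} \<Rightarrow> 'r::field) \<Rightarrow> bool \<Rightarrow> ('k, 'r, 'v::ab_group_add) rep \<Rightarrow> 'r \<Rightarrow> bool" where
  "gauss_scalar \<chi> b \<rho> c \<longleftrightarrow> (\<forall>v\<in>rspace \<rho>. gauss_op \<chi> b \<rho> v = rscale \<rho> c v)"

lemma gpow_closed [simp]: "g \<in> GL m \<Longrightarrow> gpow b m g \<in> GL m"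
  by (simp add: gpow_def)

text \<open>Both g and its inverse are compatible with conjugation. As the trace is conjugation
  invariant, a Gauss sum can thus be moved past the action of x.\<close>

lemma gpow_conj:
  fixes g x :: "'k::field mat"
  assumes "g \<in> GL m" "x \<in> GL m"
  shows "x * gpow b m g = gpow b m (x * g * GLinv m x) * x"
proof -
  have "x * h = x * h * GLinv m x * x" if "h \<in> GL m" for h
    using that assms GL_assoc[of "x * h" m "GLinv m x" x] by simp
  moreover have "GLinv m (x * g * GLinv m x) = x * GLinv m g * GLinv m x"
    using assms by (simp add: GLinv_mult GL_assoc)
  ultimately show ?thesis using assms by (auto simp: gpow_def)
qed

section \<open>Linear maps on carrier subspaces, and inheritance by subquotients\<close>

lemma is_repD:
  assumes "is_rep \<rho>"
  shows is_rep_vs: "vector_space (rscale \<rho>)"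
    and is_rep_zero: "0 \<in> rspace \<rho>"
    and is_rep_add: "v \<in> rspace \<rho> \<Longrightarrow> w \<in> rspace \<rho> \<Longrightarrow> v + w \<in> rspace \<rho>"
    and is_rep_scale: "v \<in> rspace \<rho> \<Longrightarrow> rscale \<rho> a v \<in> rspace \<rho>"
    and is_rep_act: "g \<in> GL (rdeg \<rho>) \<Longrightarrow> v \<in> rspace \<rho> \<Longrightarrow> ract \<rho> g v \<in> rspace \<rho>"
    and is_rep_lin: "g \<in> GL (rdeg \<rho>) \<Longrightarrow> linear_between (rscale \<rho>) (rspace \<rho>) (rscale \<rho>) (ract \<rho> g)"
    and is_rep_one: "v \<in> rspace \<rho> \<Longrightarrow> ract \<rho> (1\<^sub>m (rdeg \<rho>)) v = v"
    and is_rep_mult: "g \<in> GL (rdeg \<rho>) \<Longrightarrow> h \<in> GL (rdeg \<rho>) \<Longrightarrow> v \<in> rspace \<rho> \<Longrightarrow>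
      ract \<rho> (g * h) v = ract \<rho> g (ract \<rho> h v)"
proof -
  show vs: "vector_space (rscale \<rho>)" using assms by (simp add: is_rep_def)
  interpret vector_space "rscale \<rho>" by (rule vs)
  have sub: "subspace (rspace \<rho>)" using assms by (simp add: is_rep_def)
  show "0 \<in> rspace \<rho>" by (rule subspace_0[OF sub])
  show "v \<in> rspace \<rho> \<Longrightarrow> w \<in> rspace \<rho> \<Longrightarrow> v + w \<in> rspace \<rho>" by (rule subspace_add[OF sub])
  show "v \<in> rspace \<rho> \<Longrightarrow> rscale \<rho> a v \<in> rspace \<rho>" by (rule subspace_scale[OF sub])
qed (use assms in \<open>auto simp: is_rep_def image_subset_iff\<close>)

lemma linear_between_add:
  "linear_between s V s' f \<Longrightarrow> x \<in> V \<Longrightarrow> y \<in> V \<Longrightarrow> f (x + y) = f x + f y"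
  and linear_between_scale:
  "linear_between s V s' f \<Longrightarrow> x \<in> V \<Longrightarrow> f (s a x) = s' a (f x)"
  by (auto simp: linear_between_def)

lemma linear_between_zero:
  assumes "linear_between s V s' (f :: 'v::ab_group_add \<Rightarrow> 'w::ab_group_add)" "0 \<in> V"
  shows "f 0 = 0"
  using linear_between_add[OF assms(1,2,2)] by simp

lemma linear_between_sum:
  fixes f :: "'v::ab_group_add \<Rightarrow> 'w::ab_group_add"
  assumes "vector_space s" and sub: "Modules.module.subspace s V" and f: "linear_between s V s' f"
    and x: "\<And>i. i \<in> I \<Longrightarrow> x i \<in> V"
  shows "f (\<Sum>i\<in>I. s (a i) (x i)) = (\<Sum>i\<in>I. s' (a i) (f (x i)))"
proof -
  interpret vector_space s by fact
  show ?thesis using x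
  proof (induction I rule: infinite_finite_induct)
    case (insert i I)
    have "(\<Sum>i\<in>I. s (a i) (x i)) \<in> V"
      using insert.prems by (intro subspace_sum[OF sub] subspace_scale[OF sub]) auto
    then show ?case
      using insert linear_between_add[OF f] linear_between_scale[OF f] subspace_scale[OF sub] by simp
  qed (use linear_between_zero[OF f subspace_0[OF sub]] in auto)
qed

text \<open>A scalar on \<open>\<tau>\<close> is a scalar on each invariant subspace, and an
  equivariant surjection carries it over. The demand on \<open>\<tau>\<close> is only a vector space
  structure, so the lemma applies to \<open>par_ind\<close> directly.\<close>

lemma gauss_scalar_subquotient:
  assumes vs: "vector_space (rscale \<tau>)" and sq: "subquotient \<pi> \<tau>" and \<tau>: "gauss_scalar \<chi> b \<tau> c"
  shows "gauss_scalar \<chi> b \<pi> c"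
  unfolding gauss_scalar_def gauss_op_def
proof
  fix v assume v: "v \<in> rspace \<pi>"
  obtain U f where deg: "rdeg \<pi> = rdeg \<tau>" and U: "invariant_subspace \<tau> U"
    and f: "rep_hom_on \<tau> U \<pi> f" "f ` U = rspace \<pi>"
    using sq unfolding subquotient_def by blast
  obtain u where u: "u \<in> U" "f u = v" using v unfolding f(2)[symmetric] by auto
  have lin: "linear_between (rscale \<tau>) U (rscale \<pi>) f" using f by (simp add: rep_hom_on_def)
  have sub: "Modules.module.subspace (rscale \<tau>) U" using U by (simp add: invariant_subspace_def)
  have hom: "f (ract \<tau> g u) = ract \<pi> g (f u)" if "g \<in> GL (rdeg \<tau>)" for g
    using f(1) u(1) that by (simp add: rep_hom_on_def)
  let ?G = "GL (rdeg \<tau>)" and ?p = "gpow b (rdeg \<tau>)"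
  have "(\<Sum>g\<in>?G. rscale \<pi> (\<chi> (mtrace g)) (ract \<pi> (?p g) v)) =
      (\<Sum>g\<in>?G. rscale \<pi> (\<chi> (mtrace g)) (f (ract \<tau> (?p g) u)))"
    by (intro sum.cong refl) (simp add: hom flip: u(2))
  also have "\<dots> = f (\<Sum>g\<in>?G. rscale \<tau> (\<chi> (mtrace g)) (ract \<tau> (?p g) u))"
    by (rule linear_between_sum[OF vs sub lin, symmetric]) (use U u in \<open>auto simp: invariant_subspace_def image_subset_iff\<close>)
  also have "\<dots> = f (rscale \<tau> c u)"
    using \<tau> U u by (auto simp: gauss_scalar_def gauss_op_def invariant_subspace_def)
  also have "\<dots> = rscale \<pi> c v" using linear_between_scale[OF lin] u by simp
  finally show "(\<Sum>g\<in>GL (rdeg \<pi>). rscale \<pi> (\<chi> (mtrace g)) (ract \<pi> (gpow b (rdeg \<pi>) g) v)) = rscale \<pi> c v"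
    by (simp add: deg)
qed

section \<open>Gauss sums on parabolically induced representations\<close>

lemma sum_fun_apply: "(\<Sum>a\<in>A. F a) x = (\<Sum>a\<in>A. F a x)"
  by (induction A rule: infinite_finite_induct) auto

abbreviation tuple_act ::
  "('k, 'r, 'v) rep list \<Rightarrow> 'k mat list \<Rightarrow> 'v list \<Rightarrow> 'v list" where
  "tuple_act \<rho>s gs xs \<equiv> map (\<lambda>t. ract (\<rho>s ! t) (gs ! t) (xs ! t)) [0..<length \<rho>s]"

lemma tuples_Cons:
  "xs \<in> tuples (\<rho> # \<rho>s) \<longleftrightarrow> (\<exists>x ys. xs = x # ys \<and> x \<in> rspace \<rho> \<and> ys \<in> tuples \<rho>s)"
  by (cases xs) (auto simp: tuples_def All_less_Suc2)

lemma tuple_act_tuples: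
  assumes "\<And>t. t < length \<rho>s \<Longrightarrow> is_rep (\<rho>s ! t) \<and> gs ! t \<in> GL (rdeg (\<rho>s ! t))" "xs \<in> tuples \<rho>s"
  shows "tuple_act \<rho>s gs xs \<in> tuples \<rho>s"
  using assms by (auto simp: tuples_def intro!: is_rep_act)

text \<open>\<open>tensor_act\<close> precomposes forms with the action and discards forms that are
  not multilinear; this closure makes it behave correctly on pure tensors.\<close>

lemma multilinear_form_act:
  fixes \<rho>s :: "('k::field, 'r::field, 'v::ab_group_add) rep list"
  assumes \<rho>: "\<And>t. t < length \<rho>s \<Longrightarrow> is_rep (\<rho>s ! t) \<and> gs ! t \<in> GL (rdeg (\<rho>s ! t))"
    and \<beta>: "multilinear_form \<rho>s \<beta>"
  shows "multilinear_form \<rho>s (\<lambda>xs. \<beta> (tuple_act \<rho>s gs xs))"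
  unfolding multilinear_form_def
proof (intro ballI allI impI)
  fix xs t assume xs: "xs \<in> tuples \<rho>s" and t: "t < length \<rho>s"
  let ?a = "ract (\<rho>s ! t) (gs ! t)" and ?V = "rspace (\<rho>s ! t)" and ?s = "rscale (\<rho>s ! t)"
  have eq: "tuple_act \<rho>s gs (xs[t := x]) = (tuple_act \<rho>s gs xs)[t := ?a x]" for x
    using xs t by (auto simp: tuples_def nth_list_update intro!: nth_equalityI)
  have lin\<beta>: "linear_between ?s ?V (*) (\<lambda>y. \<beta> ((tuple_act \<rho>s gs xs)[t := y]))"
    using \<beta> t tuple_act_tuples[OF \<rho> xs] by (simp add: multilinear_form_def)
  have lina: "linear_between ?s ?V ?s ?a" and cl: "\<And>x. x \<in> ?V \<Longrightarrow> ?a x \<in> ?V"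
    using \<rho>[OF t] is_rep_lin is_rep_act by auto
  show "linear_between ?s ?V (*) (\<lambda>x. \<beta> (tuple_act \<rho>s gs (xs[t := x])))"
    unfolding eq
    using linear_between_add[OF lin\<beta>] linear_between_scale[OF lin\<beta>]
      linear_between_add[OF lina] linear_between_scale[OF lina] cl
    by (simp add: linear_between_def)
qed

lemma multilinear_form_Cons:
  fixes \<rho>s :: "('k::field, 'r::field, 'v::ab_group_add) rep list"
  assumes "multilinear_form (\<rho> # \<rho>s) \<beta>"
  shows "x \<in> rspace \<rho> \<Longrightarrow> multilinear_form \<rho>s (\<lambda>xs. \<beta> (x # xs))"
    and "x \<in> rspace \<rho> \<Longrightarrow> xs \<in> tuples \<rho>s \<Longrightarrow>
      linear_between (rscale \<rho>) (rspace \<rho>) (*) (\<lambda>x. \<beta> (x # xs))"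
proof -
  have *: "linear_between (rscale ((\<rho> # \<rho>s) ! t)) (rspace ((\<rho> # \<rho>s) ! t)) (*) (\<lambda>y. \<beta> ((x # xs)[t := y]))"
    if "x \<in> rspace \<rho>" "xs \<in> tuples \<rho>s" "t < Suc (length \<rho>s)" for x xs t
    by (rule assms[unfolded multilinear_form_def, rule_format]) (use that in \<open>auto simp: tuples_Cons\<close>)
  show "x \<in> rspace \<rho> \<Longrightarrow> multilinear_form \<rho>s (\<lambda>xs. \<beta> (x # xs))"
    unfolding multilinear_form_def using *[of x _ "Suc _"] by auto
  show "x \<in> rspace \<rho> \<Longrightarrow> xs \<in> tuples \<rho>s \<Longrightarrow>
      linear_between (rscale \<rho>) (rspace \<rho>) (*) (\<lambda>x. \<beta> (x # xs))"
    using *[of x xs 0] by simp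
qed

lemma sum_set_Cons: "(\<Sum>xs\<in>set_Cons A S. F xs) = (\<Sum>x\<in>A. \<Sum>xs\<in>S. F (x # xs))"
proof -
  have "set_Cons A S = (\<lambda>(x, xs). x # xs) ` (A \<times> S)" by (auto simp: set_Cons_def)
  then show ?thesis
    by (simp add: sum.reindex inj_on_def sum.cartesian_product case_prod_beta)
qed

abbreviation levi_weight :: "('k::field \<Rightarrow> 'r::field) \<Rightarrow> 'k mat list \<Rightarrow> 'r" where
  "levi_weight \<chi> gs \<equiv> prod_list (map (\<lambda>g. \<chi> (mtrace g)) gs)"

abbreviation levi_pow :: "bool \<Rightarrow> nat list \<Rightarrow> 'k::field mat list \<Rightarrow> 'k mat list" where
  "levi_pow b ns gs \<equiv> map (\<lambda>t. gpow b (ns ! t) (gs ! t)) [0..<length ns]"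

text \<open>For a fixed group element g in the first factor, the form with first argument g x is
  multilinear in the rest, so the induction hypothesis evaluates the sum over the other factors.
  Linearity in the first argument then pulls the sum over g inside the form. Hence the induction is
  over all \<open>\<beta>\<close>.\<close>

lemma sum_levi_multilinear:
  fixes \<rho>s :: "('k::{field,finite}, 'r::field, 'v::ab_group_add) rep list"
  assumes "list_all2 (gauss_scalar \<chi> b) \<rho>s cs" "\<forall>\<rho>\<in>set \<rho>s. is_rep \<rho>"
    and "multilinear_form \<rho>s \<beta>" "xs \<in> tuples \<rho>s"
  shows "(\<Sum>gs\<in>levi (map rdeg \<rho>s). levi_weight \<chi> gs *
      \<beta> (tuple_act \<rho>s (levi_pow b (map rdeg \<rho>s) gs) xs)) = prod_list cs * \<beta> xs"
  using assms
proof (induction arbitrary: \<beta> xs rule: list_all2_induct)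
  case Nil
  then show ?case by (simp add: tuples_def)
next
  case (Cons \<rho> \<rho>s c cs)
  obtain x ys where xs: "xs = x # ys" "x \<in> rspace \<rho>" "ys \<in> tuples \<rho>s"
    using Cons.prems by (auto simp: tuples_Cons)
  have \<rho>: "is_rep \<rho>" using Cons.prems by simp
  let ?p = "gpow b (rdeg \<rho>)"
  have act: "ract \<rho> (?p g) x \<in> rspace \<rho>" if "g \<in> GL (rdeg \<rho>)" for g
    using is_rep_act[OF \<rho>] that xs by simp
  have lin: "linear_between (rscale \<rho>) (rspace \<rho>) (*) (\<lambda>x. \<beta> (x # ys))"
    using multilinear_form_Cons(2)[OF Cons.prems(2) xs(2,3)] .
  have split: "tuple_act (\<rho> # \<rho>s) (levi_pow b (map rdeg (\<rho> # \<rho>s)) (g # gs)) (x # ys) =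
      ract \<rho> (?p g) x # tuple_act \<rho>s (levi_pow b (map rdeg \<rho>s) gs) ys" for g gs
    by (simp add: map_upt_Suc del: upt_Suc)
  have "(\<Sum>gs\<in>levi (map rdeg (\<rho> # \<rho>s)). levi_weight \<chi> gs *
      \<beta> (tuple_act (\<rho> # \<rho>s) (levi_pow b (map rdeg (\<rho> # \<rho>s)) gs) xs)) =
    (\<Sum>g\<in>GL (rdeg \<rho>). \<chi> (mtrace g) * (\<Sum>gs\<in>levi (map rdeg \<rho>s). levi_weight \<chi> gs *
      \<beta> (ract \<rho> (?p g) x # tuple_act \<rho>s (levi_pow b (map rdeg \<rho>s) gs) ys)))"
    unfolding xs list.map(2) listset.simps sum_set_Cons split[simplified list.map(2)]
    by (simp add: sum_distrib_left mult.assoc)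
  also have "\<dots> = (\<Sum>g\<in>GL (rdeg \<rho>). \<chi> (mtrace g) * (prod_list cs * \<beta> (ract \<rho> (?p g) x # ys)))"
    using Cons.prems xs
    by (intro sum.cong refl arg_cong2[where f = "(*)"] Cons.IH multilinear_form_Cons(1)[OF Cons.prems(2)] act) auto
  also have "\<dots> = prod_list cs * (\<Sum>g\<in>GL (rdeg \<rho>). \<chi> (mtrace g) * \<beta> (ract \<rho> (?p g) x # ys))"
    by (simp add: sum_distrib_left mult_ac)
  also have "(\<Sum>g\<in>GL (rdeg \<rho>). \<chi> (mtrace g) * \<beta> (ract \<rho> (?p g) x # ys)) =
      \<beta> ((\<Sum>g\<in>GL (rdeg \<rho>). rscale \<rho> (\<chi> (mtrace g)) (ract \<rho> (?p g) x)) # ys)"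
    using is_rep_vs[OF \<rho>] \<rho> act
    by (intro linear_between_sum[OF _ _ lin, symmetric]) (auto simp: is_rep_def)
  also have "(\<Sum>g\<in>GL (rdeg \<rho>). rscale \<rho> (\<chi> (mtrace g)) (ract \<rho> (?p g) x)) = rscale \<rho> c x"
    using Cons.hyps(1) xs by (simp add: gauss_scalar_def gauss_op_def)
  also have "\<beta> (rscale \<rho> c x # ys) = c * \<beta> xs"
    using linear_between_scale[OF lin xs(2)] xs by simp
  finally show ?case by (simp add: mult_ac)
qed

lemma vector_space_fun1: "vector_space (\<lambda>a (\<theta> :: 'a \<Rightarrow> 'r::field) \<beta>. a * \<theta> \<beta>)"
  by unfold_locales (auto simp: fun_eq_iff algebra_simps)

lemma vector_space_fun2: "vector_space (\<lambda>a (f :: 'b \<Rightarrow> 'a \<Rightarrow> 'r::field) x \<beta>. a * f x \<beta>)"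
  by unfold_locales (auto simp: fun_eq_iff algebra_simps)

lemma tensor_space_induct [consumes 1, case_names zero step]:
  assumes "\<theta> \<in> tensor_space \<rho>s" "h 0"
    "\<And>c xs \<theta>. xs \<in> tuples \<rho>s \<Longrightarrow> h \<theta> \<Longrightarrow> h (\<lambda>\<beta>. c * pure_tensor \<rho>s xs \<beta> + \<theta> \<beta>)"
  shows "h \<theta>"
proof -
  interpret vector_space "\<lambda>a \<theta> \<beta>. a * \<theta> \<beta> :: 'r::field" by (rule vector_space_fun1)
  show ?thesis
    using assms(1) unfolding tensor_space_def
  proof (induction rule: span_induct_alt)
    case base
    show ?case by (rule assms(2))
  next
    case (step c x y)
    then show ?case using assms(3) by (auto simp: plus_fun_def)
  qed
qed

lemma tensor_act_pure_tensor:
  fixes \<rho>s :: "('k::field, 'r::field, 'v::ab_group_add) rep list"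
  assumes "\<And>t. t < length \<rho>s \<Longrightarrow> is_rep (\<rho>s ! t) \<and> gs ! t \<in> GL (rdeg (\<rho>s ! t))"
  shows "tensor_act \<rho>s gs (pure_tensor \<rho>s xs) = pure_tensor \<rho>s (tuple_act \<rho>s gs xs)"
  using multilinear_form_act[OF assms] by (auto simp: tensor_act_def pure_tensor_def)

lemma tensor_act_lin:
  "tensor_act \<rho>s gs (\<lambda>\<beta>. c * \<theta> \<beta> + \<theta>' \<beta>) = (\<lambda>\<beta>. c * tensor_act \<rho>s gs \<theta> \<beta> + tensor_act \<rho>s gs \<theta>' \<beta>)"
  "tensor_act \<rho>s gs (\<lambda>\<beta>. 0) = (\<lambda>\<beta>. 0)"
  by (auto simp: tensor_act_def)

text \<open>Applied to the diagonal blocks of a unipotent element, this makes the functions in an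
  induced representation left invariant under the unipotent radical.\<close>

lemma tensor_act_one:
  fixes \<rho>s :: "('k::field, 'r::field, 'v::ab_group_add) rep list"
  assumes "\<forall>\<rho>\<in>set \<rho>s. is_rep \<rho>" "\<And>t. t < length \<rho>s \<Longrightarrow> gs ! t = 1\<^sub>m (rdeg (\<rho>s ! t))"
    and "\<theta> \<in> tensor_space \<rho>s"
  shows "tensor_act \<rho>s gs \<theta> = \<theta>"
  using assms(3)
proof (induction rule: tensor_space_induct)
  case (step c xs \<theta>)
  have "tuple_act \<rho>s gs xs = xs"
    using assms step.hyps by (auto simp: tuples_def is_rep_one intro!: nth_equalityI)
  then show ?case
    using assms step by (simp add: tensor_act_lin tensor_act_pure_tensor)
qed (simp add: zero_fun_def tensor_act_lin)

text \<open>Linearity reduces to pure tensors, whose values at a multilinear \<open>\<beta>\<close>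
  are values of \<open>\<beta>\<close>; at any other \<open>\<beta>\<close> both sides are 0 by
  convention.\<close>

lemma sum_levi_tensor_act:
  fixes \<rho>s :: "('k::{field,finite}, 'r::field, 'v::ab_group_add) rep list"
  assumes sc: "list_all2 (gauss_scalar \<chi> b) \<rho>s cs" and \<rho>: "\<forall>\<rho>\<in>set \<rho>s. is_rep \<rho>"
    and "\<theta> \<in> tensor_space \<rho>s"
  shows "(\<Sum>gs\<in>levi (map rdeg \<rho>s). levi_weight \<chi> gs *
      tensor_act \<rho>s (levi_pow b (map rdeg \<rho>s) gs) \<theta> \<beta>) = prod_list cs * \<theta> \<beta>"
  using assms(3)
proof (induction rule: tensor_space_induct)
  case (step c xs \<theta>)
  let ?L = "levi (map rdeg \<rho>s) :: 'k mat list set" and ?p = "levi_pow b (map rdeg \<rho>s)"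
  have "(\<Sum>gs\<in>?L. levi_weight \<chi> gs * tensor_act \<rho>s (?p gs) (pure_tensor \<rho>s xs) \<beta>) =
      (\<Sum>gs\<in>?L. levi_weight \<chi> gs * pure_tensor \<rho>s (tuple_act \<rho>s (?p gs) xs) \<beta>)"
  proof (intro sum.cong refl)
    fix gs :: "'k mat list" assume "gs \<in> ?L"
    then have "gs ! t \<in> GL (rdeg (\<rho>s ! t))" if "t < length \<rho>s" for t
      using that unfolding in_levi_iff by simp
    then show "levi_weight \<chi> gs * tensor_act \<rho>s (?p gs) (pure_tensor \<rho>s xs) \<beta> =
        levi_weight \<chi> gs * pure_tensor \<rho>s (tuple_act \<rho>s (?p gs) xs) \<beta>"
      using \<rho> by (subst tensor_act_pure_tensor) auto
  qed
  also have "\<dots> = prod_list cs * pure_tensor \<rho>s xs \<beta>"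
    using sum_levi_multilinear[OF sc \<rho> _ step.hyps, of \<beta>]
    by (cases "multilinear_form \<rho>s \<beta>") (simp_all add: pure_tensor_def)
  finally have 1: "(\<Sum>gs\<in>?L. levi_weight \<chi> gs * tensor_act \<rho>s (?p gs) (pure_tensor \<rho>s xs) \<beta>) =
      prod_list cs * pure_tensor \<rho>s xs \<beta>" .
  have "(\<Sum>gs\<in>?L. levi_weight \<chi> gs * tensor_act \<rho>s (?p gs) (\<lambda>\<beta>. c * pure_tensor \<rho>s xs \<beta> + \<theta> \<beta>) \<beta>) =
      c * (\<Sum>gs\<in>?L. levi_weight \<chi> gs * tensor_act \<rho>s (?p gs) (pure_tensor \<rho>s xs) \<beta>) +
      (\<Sum>gs\<in>?L. levi_weight \<chi> gs * tensor_act \<rho>s (?p gs) \<theta> \<beta>)"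
    unfolding sum_distrib_left sum.distrib[symmetric] tensor_act_lin
    by (intro sum.cong refl) (simp add: algebra_simps)
  then show ?case unfolding 1 step.IH by (simp add: algebra_simps)
qed (simp add: zero_fun_def tensor_act_lin)

section \<open>The Gauss sum on an induced representation\<close>

lemma rdeg_par_ind [simp]: "rdeg (par_ind \<rho>s) = sum_list (map rdeg \<rho>s)"
  and rscale_par_ind [simp]: "rscale (par_ind \<rho>s) = (\<lambda>a f x \<beta>. a * f x \<beta>)"
  and ract_par_ind: "ract (par_ind \<rho>s) = (\<lambda>g f x. if x \<in> GL (sum_list (map rdeg \<rho>s)) then f (x * g) else 0)"
  by (simp_all add: par_ind_def Let_def)

lemma in_rspace_par_ind:
  "f \<in> rspace (par_ind \<rho>s) \<longleftrightarrow> (\<forall>x\<in>GL (sum_list (map rdeg \<rho>s)). f x \<in> tensor_space \<rho>s) \<and>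
     (\<forall>x. x \<notin> GL (sum_list (map rdeg \<rho>s)) \<longrightarrow> f x = 0) \<and>
     (\<forall>p\<in>std_parabolic (map rdeg \<rho>s). \<forall>x\<in>GL (sum_list (map rdeg \<rho>s)).
        f (p * x) = tensor_act \<rho>s (dblocks (map rdeg \<rho>s) p) (f x))"
  by (simp add: par_ind_def Let_def)

lemma sum_GL_conj:
  fixes F :: "'k::{field,finite} mat \<Rightarrow> 'a::comm_monoid_add"
  assumes "x \<in> GL m"
  shows "(\<Sum>g\<in>GL m. F (x * g * GLinv m x)) = (\<Sum>g\<in>GL m. F g)"
  using sum_GL_left[OF assms, of "\<lambda>g. F (g * GLinv m x)"] sum_GL_right[OF GLinv_closed[OF assms], of F]
  by simp

text \<open>The group acts by right translation, whereas equivariance under the parabolic subgroup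
  is on the left. At a point x, conjugating the summation variable by x turns f (x g) into f (g x)
  and leaves the trace alone; then the sum can be restricted to the parabolic subgroup and evaluated
  on its Levi quotient.\<close>

lemma gauss_scalar_par_ind:
  fixes \<rho>s :: "('k::{field,finite}, 'r::field, 'v::ab_group_add) rep list" and \<chi> :: "'k \<Rightarrow> 'r"
  assumes \<chi>: "additive_character \<chi>" "\<exists>x. \<chi> x \<noteq> 1" and q: "of_nat (CARD('k)) \<noteq> (0::'r)"
    and sc: "list_all2 (gauss_scalar \<chi> b) \<rho>s cs" and \<rho>: "\<forall>\<rho>\<in>set \<rho>s. is_rep \<rho>"
  shows "gauss_scalar \<chi> b (par_ind \<rho>s) (of_nat (CARD('k)) ^ card (upper_pairs (map rdeg \<rho>s)) * prod_list cs)"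
  unfolding gauss_scalar_def gauss_op_def rdeg_par_ind rscale_par_ind ract_par_ind
proof (intro ballI ext)
  fix f x \<beta> assume f: "f \<in> rspace (par_ind \<rho>s)"
  let ?ns = "map rdeg \<rho>s"
  let ?m = "sum_list ?ns" and ?C = "of_nat (CARD('k)) ^ card (upper_pairs ?ns) * prod_list cs :: 'r"
  have tens: "f y \<in> tensor_space \<rho>s" if "y \<in> GL ?m" for y using f that by (simp add: in_rspace_par_ind)
  have zero: "f y = 0" if "y \<notin> GL ?m" for y using f that by (simp add: in_rspace_par_ind)
  have equi: "f (p * y) = tensor_act \<rho>s (dblocks ?ns p) (f y)"
    if "p \<in> std_parabolic ?ns" "y \<in> GL ?m" for p y using f that by (simp add: in_rspace_par_ind)
  have unip: "f (u * y) = f y"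
    if "u \<in> GL ?m" "u \<in> std_parabolic ?ns" "\<And>t. t < length ?ns \<Longrightarrow> dblock ?ns t u = 1\<^sub>m (?ns ! t)" "y \<in> GL ?m" for u y
    using tensor_act_one[OF \<rho> _ tens[OF that(4)], of "dblocks ?ns u"] equi[of u y] that by simp
  show "(\<Sum>g\<in>GL ?m. (\<lambda>x \<beta>. \<chi> (mtrace g) * (if x \<in> GL ?m then f (x * gpow b ?m g) else 0) \<beta>)) x \<beta> =
    ?C * f x \<beta>"
  proof (cases "x \<in> GL ?m")
    case False
    then show ?thesis by (simp add: sum_fun_apply zero)
  next
    case x: True
    define \<phi> where "\<phi> g = f (gpow b ?m g * x) \<beta>" for g
    have "(\<Sum>g\<in>GL ?m. (\<lambda>x \<beta>. \<chi> (mtrace g) * (if x \<in> GL ?m then f (x * gpow b ?m g) else 0) \<beta>)) x \<beta> =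
        (\<Sum>g\<in>GL ?m. \<chi> (mtrace (x * g * GLinv ?m x)) * \<phi> (x * g * GLinv ?m x))"
      unfolding sum_fun_apply \<phi>_def using x gpow_conj[OF _ x] by (intro sum.cong) (auto simp: mtrace_GLinv_conj)
    also have "\<dots> = (\<Sum>g\<in>GL ?m. \<chi> (mtrace g) * \<phi> g)" by (rule sum_GL_conj[OF x])
    also have "\<dots> = (\<Sum>p\<in>std_parabolic ?ns. \<chi> (mtrace p) * \<phi> p)"
    proof (rule sum_GL_parabolic[OF \<chi> q])
      show "(\<forall>u\<in>std_unipotent ?ns. \<forall>g\<in>GL ?m. \<phi> (u * g) = \<phi> g) \<or>
          (\<forall>u\<in>std_unipotent ?ns. \<forall>g\<in>GL ?m. \<phi> (g * u) = \<phi> g)"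
      \<comment> \<open>Left invariance of \<open>f\<close> becomes left invariance of
        \<open>\<phi>\<close> when g enters directly, and right invariance when g enters
        inverted.\<close>
      proof (cases b)
        case False
        have "\<phi> (u * g) = \<phi> g" if "u \<in> std_unipotent ?ns" "g \<in> GL ?m" for u g
        proof -
          have u: "u \<in> GL ?m" using that std_unipotent_GL by blast
          then have "f (u * (g * x)) = f (g * x)"
            using that x by (intro unip) (auto simp: std_unipotent_def)
          then show ?thesis using that x u False by (simp add: \<phi>_def gpow_def GL_assoc)
        qed
        then show ?thesis by blast
      next
        case True
        have "\<phi> (g * u) = \<phi> g" if "u \<in> std_unipotent ?ns" "g \<in> GL ?m" for u g
        proof -
          have u: "u \<in> GL ?m" using that std_unipotent_GL by blast
          have "f (GLinv ?m u * (GLinv ?m g * x)) = f (GLinv ?m g * x)"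
            using that x u by (intro unip) (auto simp: std_unipotent_def GLinv_std_parabolic dblock_GLinv)
          then show ?thesis using that x u True by (simp add: \<phi>_def gpow_def GL_assoc[where m = ?m] GLinv_mult)
        qed
        then show ?thesis by blast
      qed
    qed
    also have "\<dots> = (\<Sum>p\<in>std_parabolic ?ns. (\<lambda>gs. levi_weight \<chi> gs *
        tensor_act \<rho>s (levi_pow b ?ns gs) (f x) \<beta>) (dblocks ?ns p))"
    proof (intro sum.cong refl)
      fix p :: "'k mat" assume p: "p \<in> std_parabolic ?ns"
      then have pG: "p \<in> GL ?m" by (simp add: std_parabolic_def)
      have "gpow b ?m p \<in> std_parabolic ?ns" using p by (simp add: gpow_def GLinv_std_parabolic)
      then have "\<phi> p = tensor_act \<rho>s (dblocks ?ns (gpow b ?m p)) (f x) \<beta>"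
        using equi[of "gpow b ?m p" x] x by (simp add: \<phi>_def)
      moreover have "dblocks ?ns (gpow b ?m p) = levi_pow b ?ns (dblocks ?ns p)"
        using p by (auto simp: gpow_def dblock_GLinv)
      ultimately have "\<phi> p = tensor_act \<rho>s (levi_pow b ?ns (dblocks ?ns p)) (f x) \<beta>"
        by (simp only:)
      moreover have "\<chi> (mtrace p) = levi_weight \<chi> (dblocks ?ns p)"
        by (simp add: mtrace_dblocks[OF GL_carrier[OF pG]] additive_character_sum[OF \<chi>(1)] comp_def
          lessThan_atLeast0 prod.list_conv_set_nth)
      ultimately show "\<chi> (mtrace p) * \<phi> p = (\<lambda>gs. levi_weight \<chi> gs *
        tensor_act \<rho>s (levi_pow b ?ns gs) (f x) \<beta>) (dblocks ?ns p)" by simp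
    qed
    also have "\<dots> = ?C * f x \<beta>"
      unfolding sum_std_parabolic[of "\<lambda>gs. levi_weight \<chi> gs * tensor_act \<rho>s (levi_pow b ?ns gs) (f x) \<beta>"]
        sum_levi_tensor_act[OF sc \<rho> tens[OF x]] by (simp only: mult.assoc)
    finally show ?thesis .
  qed
qed

section \<open>Schur's lemma for Gauss sums\<close>

text \<open>The vector p(T) v as an explicit sum over iterates, since \<open>T\<close> is linear
  only on a subspace of the type.\<close>

definition poly_act ::
  "('r::field \<Rightarrow> 'v::ab_group_add \<Rightarrow> 'v) \<Rightarrow> 'r poly \<Rightarrow> ('v \<Rightarrow> 'v) \<Rightarrow> 'v \<Rightarrow> 'v" where
  "poly_act s p T v = (\<Sum>i\<le>degree p. s (coeff p i) ((T ^^ i) v))"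

lemma poly_act_bound:
  assumes "vector_space s" "degree p \<le> n"
  shows "poly_act s p T v = (\<Sum>i\<le>n. s (coeff p i) ((T ^^ i) v))"
proof -
  interpret vector_space s by fact
  show ?thesis
    unfolding poly_act_def by (rule sum.mono_neutral_left) (use assms in \<open>auto simp: coeff_eq_0\<close>)
qed

lemma poly_act_linear_factor:
  assumes vs: "vector_space s" and V: "Modules.module.subspace s V"
    and T: "linear_between s V s T" "T ` V \<subseteq> V" and v: "v \<in> V"
  shows "poly_act s ([:- a, 1:] * q) T v = T (poly_act s q T v) - s a (poly_act s q T v)"
proof -
  interpret vector_space s by (rule vs)
  have it: "(T ^^ i) v \<in> V" for i using T(2) v by (induction i) auto
  let ?n = "degree q"
  have deg: "degree ([:- a, 1:] * q) \<le> Suc ?n"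
    using degree_mult_le[of "[:- a, 1:]" q] by simp
  have co: "coeff ([:- a, 1:] * q) i = (case i of 0 \<Rightarrow> 0 | Suc j \<Rightarrow> coeff q j) - a * coeff q i" for i
    by (simp add: coeff_pCons split: nat.splits)
  have "poly_act s ([:- a, 1:] * q) T v =
      (\<Sum>i\<le>Suc ?n. s (case i of 0 \<Rightarrow> 0 | Suc j \<Rightarrow> coeff q j) ((T ^^ i) v)) -
      (\<Sum>i\<le>Suc ?n. s (a * coeff q i) ((T ^^ i) v))"
    unfolding poly_act_bound[OF vs deg] co by (simp only: scale_left_diff_distrib sum_subtractf)
  also have "(\<Sum>i\<le>Suc ?n. s (case i of 0 \<Rightarrow> 0 | Suc j \<Rightarrow> coeff q j) ((T ^^ i) v)) =
      (\<Sum>i\<le>?n. s (coeff q i) (T ((T ^^ i) v)))"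
    by (subst sum.atMost_Suc_shift) simp
  also have "\<dots> = T (poly_act s q T v)"
    unfolding poly_act_def by (rule linear_between_sum[OF vs V T(1), symmetric]) (rule it)
  \<comment> \<open>The bound \<open>Suc ?n\<close> exceeds the degree of \<open>q\<close> by one,
    and the additional coefficient is zero.\<close>
  also have "(\<Sum>i\<le>Suc ?n. s (a * coeff q i) ((T ^^ i) v)) = s a (poly_act s q T v)"
    using poly_act_bound[OF vs, of q "Suc ?n" T v] by (simp add: scale_sum_right scale_right_distrib)
  finally show ?thesis .
qed

text \<open>Roots of the annihilating polynomial are split off one by one. If p = (X - a) q, then
  q(T) v is an eigenvector for a unless it is zero, and in that case q annihilates v and has smaller
  degree. A nonzero constant cannot annihilate v.\<close>

lemma eigenvector_exists_poly:
  fixes s :: "'r::alg_closed_field \<Rightarrow> 'v::ab_group_add \<Rightarrow> 'v"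
  assumes vs: "vector_space s" and V: "Modules.module.subspace s V"
    and T: "linear_between s V s T" "T ` V \<subseteq> V" and v: "v \<in> V" "v \<noteq> 0"
    and p: "p \<noteq> 0" "poly_act s p T v = 0"
  shows "\<exists>a w. w \<in> V \<and> w \<noteq> 0 \<and> T w = s a w"
proof -
  interpret vector_space s by (rule vs)
  show ?thesis using p
  proof (induction "degree p" arbitrary: p rule: less_induct)
    case less
    show ?case
    proof (cases "degree p = 0")
      case True
      then obtain c where "p = [:c:]" by (metis degree_eq_zeroE)
      then show ?thesis using less.prems v by (simp add: poly_act_def)
    next
      case False
      then obtain a where "poly p a = 0" using alg_closed_imp_poly_has_root by blast
      then obtain q where q: "p = [:- a, 1:] * q" by (metis poly_eq_0_iff_dvd dvdE)
      have q0: "q \<noteq> 0" using less.prems q by auto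
      let ?w = "poly_act s q T v"
      have "T ?w = s a ?w"
        using poly_act_linear_factor[OF vs V T v(1), of a q] less.prems q by simp
      moreover have "?w \<in> V"
      proof -
        have "(T ^^ i) v \<in> V" for i using T(2) v by (induction i) auto
        then show ?thesis unfolding poly_act_def by (intro subspace_sum[OF V] subspace_scale[OF V]) auto
      qed
      moreover have ?thesis if "?w = 0"
      proof (rule less.hyps[OF _ q0 that])
        show "degree q < degree p" unfolding q using q0 by (subst degree_mult_eq) auto
      qed
      ultimately show ?thesis by blast
    qed
  qed
qed

text \<open>Finite dimension is asked only of the span containing the iterates of v. The
  \<open>card B + 1\<close> vectors from v to T^n v, with n = \<open>card B\<close>, must satisfy a
  linear relation, whose coefficients form an annihilating polynomial.\<close>

lemma eigenvector_exists:
  fixes s :: "'r::alg_closed_field \<Rightarrow> 'v::ab_group_add \<Rightarrow> 'v"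
  assumes vs: "vector_space s" and V: "Modules.module.subspace s V"
    and T: "linear_between s V s T" "T ` V \<subseteq> V" and v: "v \<in> V" "v \<noteq> 0"
    and B: "finite B" "\<And>i. (T ^^ i) v \<in> Modules.module.span s B"
  shows "\<exists>a w. w \<in> V \<and> w \<noteq> 0 \<and> T w = s a w"
proof -
  interpret vector_space s by (rule vs)
  let ?n = "card B" and ?f = "\<lambda>i. (T ^^ i) v"
  have "\<exists>p. p \<noteq> 0 \<and> poly_act s p T v = 0"
  \<comment> \<open>\<open>dependent\<close> speaks of sets, so repeated iterates need separate
    treatment; there X^i - X^j annihilates v.\<close>
  proof (cases "inj_on ?f {..?n}")
    case False
    then obtain i j where ij: "i \<noteq> j" "?f i = ?f j" by (auto simp: inj_on_def)
    let ?p = "monom 1 i - monom 1 j :: 'r poly"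
    have "coeff ?p i \<noteq> 0" using not_sym[OF ij(1)] by simp
    then have "?p \<noteq> 0" by (metis coeff_0)
    moreover have "degree ?p \<le> i + j"
      by (intro degree_diff_le) (auto intro: order.trans[OF degree_monom_le])
    then have "poly_act s ?p T v = (\<Sum>k\<le>i + j. s (coeff ?p k) (?f k))" by (rule poly_act_bound[OF vs])
    then have "poly_act s ?p T v = (\<Sum>k\<le>i + j. if k = i then ?f i else 0) - (\<Sum>k\<le>i + j. if k = j then ?f j else 0)"
      unfolding sum_subtractf[symmetric] using ij by (auto intro!: sum.cong)
    then have "poly_act s ?p T v = 0" using ij by simp
    ultimately show ?thesis by blast
  next
    case True
    have "dependent (?f ` {..?n})"
    proof (rule ccontr)
      assume "independent (?f ` {..?n})"
      from independent_span_bound[OF B(1) this] B(2) card_image[OF True] show False by auto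
    qed
    then obtain u where u: "\<exists>w\<in>?f ` {..?n}. u w \<noteq> 0" "(\<Sum>w\<in>?f ` {..?n}. s (u w) w) = 0"
      by (auto simp: dependent_finite)
    define p where "p = (\<Sum>i\<le>?n. monom (u (?f i)) i)"
    have co: "coeff p i = (if i \<le> ?n then u (?f i) else 0)" for i
      by (simp add: p_def coeff_sum)
    then have "degree p \<le> ?n" by (intro degree_le) auto
    then have "poly_act s p T v = (\<Sum>i\<le>?n. s (coeff p i) (?f i))" by (rule poly_act_bound[OF vs])
    also have "\<dots> = (\<Sum>i\<le>?n. s (u (?f i)) (?f i))" by (intro sum.cong) (auto simp: co)
    also have "\<dots> = 0" using u(2) by (simp add: sum.reindex[OF True])
    finally have "poly_act s p T v = 0" .
    moreover obtain i where "i \<le> ?n" "u (?f i) \<noteq> 0" using u(1) by auto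
    then have "coeff p i \<noteq> 0" by (simp add: co)
    then have "p \<noteq> 0" by (metis coeff_0)
    ultimately show ?thesis by blast
  qed
  then obtain p where "p \<noteq> 0" "poly_act s p T v = 0" by blast
  then show ?thesis by (rule eigenvector_exists_poly[OF vs V T v])
qed

section \<open>Gauss sums as intertwining operators\<close>

lemma is_rep_subspace: "is_rep \<rho> \<Longrightarrow> Modules.module.subspace (rscale \<rho>) (rspace \<rho>)"
  by (simp add: is_rep_def)

lemma
  assumes "is_rep (\<rho> :: ('k::{field,finite}, 'r::field, 'v::ab_group_add) rep)"
  shows gauss_op_closed: "v \<in> rspace \<rho> \<Longrightarrow> gauss_op \<chi> b \<rho> v \<in> rspace \<rho>"
    and gauss_op_linear: "linear_between (rscale \<rho>) (rspace \<rho>) (rscale \<rho>) (gauss_op \<chi> b \<rho>)"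
proof -
  interpret vector_space "rscale \<rho>" using is_rep_vs[OF assms] .
  note V = is_rep_subspace[OF assms]
  show "v \<in> rspace \<rho> \<Longrightarrow> gauss_op \<chi> b \<rho> v \<in> rspace \<rho>"
    unfolding gauss_op_def by (intro subspace_sum[OF V] subspace_scale[OF V] is_rep_act[OF assms]) auto
  have lin: "linear_between (rscale \<rho>) (rspace \<rho>) (rscale \<rho>) (ract \<rho> (gpow b (rdeg \<rho>) g))"
    if "g \<in> GL (rdeg \<rho>)" for g
    using is_rep_lin[OF assms] that by simp
  show "linear_between (rscale \<rho>) (rspace \<rho>) (rscale \<rho>) (gauss_op \<chi> b \<rho>)"
    unfolding linear_between_def gauss_op_def scale_sum_right sum.distrib[symmetric]
    by (intro conjI ballI allI sum.cong refl)
      (simp_all add: linear_between_add[OF lin] linear_between_scale[OF lin] scale_right_distrib mult.commute)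
qed

lemma gauss_op_commute:
  assumes \<rho>: "is_rep (\<rho> :: ('k::{field,finite}, 'r::field, 'v::ab_group_add) rep)"
    and h: "h \<in> GL (rdeg \<rho>)" and v: "v \<in> rspace \<rho>"
  shows "ract \<rho> h (gauss_op \<chi> b \<rho> v) = gauss_op \<chi> b \<rho> (ract \<rho> h v)"
proof -
  let ?G = "GL (rdeg \<rho>)" and ?p = "gpow b (rdeg \<rho>)" and ?c = "\<lambda>g. h * g * GLinv (rdeg \<rho>) h"
  have "ract \<rho> h (gauss_op \<chi> b \<rho> v) = (\<Sum>g\<in>?G. rscale \<rho> (\<chi> (mtrace g)) (ract \<rho> h (ract \<rho> (?p g) v)))"
    unfolding gauss_op_def
    by (rule linear_between_sum[OF is_rep_vs[OF \<rho>] is_rep_subspace[OF \<rho>] is_rep_lin[OF \<rho> h]])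
      (simp add: is_rep_act[OF \<rho>] v)
  also have "\<dots> = (\<Sum>g\<in>?G. rscale \<rho> (\<chi> (mtrace (?c g))) (ract \<rho> (?p (?c g)) (ract \<rho> h v)))"
  proof (intro sum.cong refl)
    fix g :: "'k mat" assume g: "g \<in> ?G"
    have "ract \<rho> h (ract \<rho> (?p g) v) = ract \<rho> (h * ?p g) v"
      using is_rep_mult[OF \<rho> h] g v by simp
    also have "\<dots> = ract \<rho> (?p (?c g)) (ract \<rho> h v)"
      unfolding gpow_conj[OF g h] using g h v by (intro is_rep_mult[OF \<rho>]) auto
    finally show "rscale \<rho> (\<chi> (mtrace g)) (ract \<rho> h (ract \<rho> (?p g) v)) =
        rscale \<rho> (\<chi> (mtrace (?c g))) (ract \<rho> (?p (?c g)) (ract \<rho> h v))"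
      using g h by (simp add: mtrace_GLinv_conj)
  qed
  also have "\<dots> = gauss_op \<chi> b \<rho> (ract \<rho> h v)"
    unfolding gauss_op_def by (rule sum_GL_conj[OF h])
  finally show ?thesis .
qed

text \<open>The Gauss sum commutes with the group, so each of its eigenspaces is invariant and a
  nonzero one is everything. An eigenvector exists because the orbit of a vector under the finite
  group is finite and the Gauss sum preserves its span.\<close>

lemma irreducible_gauss_scalar:
  fixes \<rho> :: "('k::{field,finite}, 'r::alg_closed_field, 'v::ab_group_add) rep"
  assumes irr: "irreducible_rep \<rho>"
  shows "\<exists>c. gauss_scalar \<chi> b \<rho> c"
proof -
  have \<rho>: "is_rep \<rho>" and nz: "rspace \<rho> \<noteq> {0}" using irr by (auto simp: irreducible_rep_def)
  interpret vector_space "rscale \<rho>" using is_rep_vs[OF \<rho>] .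
  let ?V = "rspace \<rho>" and ?T = "gauss_op \<chi> b \<rho>" and ?G = "GL (rdeg \<rho>)"
  note V = is_rep_subspace[OF \<rho>] and T = gauss_op_linear[OF \<rho>, of \<chi> b]
  obtain v where v: "v \<in> ?V" "v \<noteq> 0" using nz subspace_0[OF V] by auto
  let ?B = "(\<lambda>g. ract \<rho> g v) ` ?G"
  have BV: "span ?B \<subseteq> ?V" by (rule span_minimal[OF _ V]) (auto simp: is_rep_act[OF \<rho>] v)
  have TB: "?T x \<in> span ?B" if "x \<in> span ?B" for x
  proof -
    have "x \<in> ?V \<and> ?T x \<in> span ?B"
      using that
    proof (induction rule: span_induct_alt)
      case base
      show ?case using linear_between_zero[OF T] subspace_0[OF V] by (simp add: span_zero)
    next
      case (step c x y)
      then obtain g where g: "g \<in> ?G" "x = ract \<rho> g v" by auto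
      have xV: "x \<in> ?V" using g v is_rep_act[OF \<rho>] by simp
      have "?T x = (\<Sum>h\<in>?G. rscale \<rho> (\<chi> (mtrace h)) (ract \<rho> (gpow b (rdeg \<rho>) h * g) v))"
        unfolding gauss_op_def using g v is_rep_mult[OF \<rho>] by (intro sum.cong) auto
      also have "\<dots> \<in> span ?B" using g by (intro span_sum span_scale span_base) auto
      finally have "?T x \<in> span ?B" .
      then have "rscale \<rho> c (?T x) + ?T y \<in> span ?B" using step by (intro span_add span_scale) auto
      moreover have "?T (rscale \<rho> c x + y) = rscale \<rho> c (?T x) + ?T y"
        using linear_between_add[OF T] linear_between_scale[OF T] subspace_scale[OF V] xV step by simp
      ultimately show ?case using subspace_add[OF V subspace_scale[OF V xV]] step by simp
    qed
    then show ?thesis ..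
  qed
  have "v \<in> span ?B"
    using is_rep_one[OF \<rho> v(1)] by (intro span_base image_eqI[of _ _ "1\<^sub>m (rdeg \<rho>)"]) auto
  then have it: "(?T ^^ i) v \<in> span ?B" for i by (induction i) (auto intro: TB)
  have im: "?T ` ?V \<subseteq> ?V" using gauss_op_closed[OF \<rho>] by blast
  have "finite ?B" by simp
  then obtain a w where w: "w \<in> ?V" "w \<noteq> 0" "?T w = rscale \<rho> a w"
    using eigenvector_exists[OF is_rep_vs[OF \<rho>] V T im v _ it] by blast
  define E where "E = {x \<in> ?V. ?T x = rscale \<rho> a x}"
  have "invariant_subspace \<rho> E"
    unfolding invariant_subspace_def
  proof (intro conjI ballI)
    show "subspace E"
      unfolding E_def using linear_between_zero[OF T subspace_0[OF V]] linear_between_add[OF T] linear_between_scale[OF T]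
        subspace_0[OF V] subspace_add[OF V] subspace_scale[OF V]
      by (intro subspaceI) (auto simp: scale_right_distrib scale_left_commute)
    fix g :: "'k mat" assume g: "g \<in> ?G"
    show "ract \<rho> g ` E \<subseteq> E"
      unfolding E_def using gauss_op_commute[OF \<rho> g, symmetric] is_rep_act[OF \<rho> g]
        linear_between_scale[OF is_rep_lin[OF \<rho> g]] by auto
  qed (auto simp: E_def)
  moreover have "E \<noteq> {0}" using w by (auto simp: E_def)
  ultimately have "E = ?V" using irr unfolding irreducible_rep_def by blast
  then have "gauss_scalar \<chi> b \<rho> a" by (auto simp: gauss_scalar_def E_def)
  then show ?thesis ..
qed

section \<open>Cuspidal representations\<close>

text \<open>Row reduction of a singular matrix produces a zero last row: after the change of basis
  \<open>P\<close>, its image lies in the hyperplane of the first m - 1 basis vectors.\<close>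

lemma singular_decomposition:
  fixes g :: "'k::field mat"
  assumes g: "g \<in> carrier_mat m m" "g \<notin> GL m"
  obtains P where "P \<in> GL m" "0 < m" "\<And>j. j < m \<Longrightarrow> (P * g) $$ (m - 1, j) = 0"
proof -
  have "det g = 0" using g by (simp add: GL_iff del: GL_carrier)
  from det_zero_imp_zero_row[OF g(1) this, of "()"]
  obtain P where P: "P \<in> Units (ring_mat TYPE('k) m ())" "row (P * g) (m - 1) = 0\<^sub>v m" "0 < m" by blast
  have PG: "P \<in> GL m" using P(1) by (simp add: GLgroup_def units_of_carrier)
  have "(P * g) $$ (m - 1, j) = 0" if "j < m" for j
    using arg_cong[OF P(2), of "\<lambda>w. vec_index w j"] that PG[THEN GL_carrier] g(1) P(3) by auto
  then show thesis using that PG P(3) by blast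
qed

lemma GL_cancel:
  fixes A :: "'k::field mat"
  assumes "P \<in> GL m" "A \<in> carrier_mat m m"
  shows "GLinv m P * (P * A) = A"
  using assoc_mult_mat[of "GLinv m P" m m P m A m] assms by simp

lemma singular_one:
  fixes g :: "'k::field mat"
  assumes "g \<in> carrier_mat 1 1" "g \<notin> GL 1"
  shows "g = 0\<^sub>m 1 1"
proof -
  obtain P where P: "P \<in> GL 1" "\<And>j. j < 1 \<Longrightarrow> (P * g) $$ (1 - 1, j) = 0"
    using singular_decomposition[OF assms] by metis
  have "P * g \<in> carrier_mat 1 1" using mult_carrier_mat[OF GL_carrier[OF P(1)] assms(1)] .
  then have "P * g = 0\<^sub>m 1 1"
    by (intro eq_matI) (use P(2) in \<open>auto simp del: index_mult_mat\<close>)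
  then show ?thesis using GL_cancel[OF P(1) assms(1)] GL_carrier[OF GLinv_closed[OF P(1)]] by simp
qed

text \<open>The columns of \<open>X\<close> lie in the span of the first m - 1 basis vectors, on
  which the unipotent radical of type (m - 1, 1) acts as the identity.\<close>

lemma unipotent_fixes:
  fixes X :: "'k::field mat"
  assumes u: "u \<in> std_unipotent [m - 1, 1]" and m: "2 \<le> m" and X: "X \<in> carrier_mat m m"
    and row: "\<And>j. j < m \<Longrightarrow> X $$ (m - 1, j) = 0"
  shows "u * X = X"
proof (rule eq_matI)
  have uc: "u \<in> carrier_mat m m"
    using std_unipotent_GL[OF u, THEN GL_carrier] m by simp
  fix i j assume "i < dim_row X" "j < dim_col X"
  then have ij: "i < m" "j < m" using X by auto
  define ns where "ns = [m - 1, 1]"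
  have ns: "length ns = 2" "sum_list ns = m" "offset ns 1 = m - 1" "ns ! 0 = m - 1"
    using m by (simp_all add: ns_def offset_def)
  have par: "\<forall>t<length ns. \<forall>i<sum_list ns. \<forall>j<sum_list ns.
      offset ns t \<le> i \<and> j < offset ns t \<longrightarrow> u $$ (i, j) = 0"
    and one: "\<forall>t<length ns. dblock ns t u = 1\<^sub>m (ns ! t)"
    using u unfolding std_unipotent_def std_parabolic_def ns_def by blast+
  have low: "u $$ (m - 1, k) = 0" if "k < m - 1" for k
    by (rule par[rule_format, of 1]) (use ns m that in simp_all)
  have top: "u $$ (i, k) = (if i = k then 1 else 0)" if "i < m - 1" "k < m - 1" for i k
  proof -
    have "dblock ns 0 u = 1\<^sub>m (m - 1)" using one ns by auto
    from arg_cong[OF this, of "\<lambda>A. A $$ (i, k)"] that show ?thesis by (simp add: dblock_def ns)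
  qed
  have "(u * X) $$ (i, j) = (\<Sum>k<m. u $$ (i, k) * X $$ (k, j))"
    using uc X ij by (auto simp: scalar_prod_def lessThan_atLeast0 intro!: sum.cong)
  also have "\<dots> = (\<Sum>k<m. if k = i then X $$ (i, j) else 0)"
  proof (intro sum.cong refl)
    fix k assume "k \<in> {..<m}"
    then show "u $$ (i, k) * X $$ (k, j) = (if k = i then X $$ (i, j) else 0)"
      using low[of k] top[of i k] row[OF ij(2)] ij m
      by (cases "k = m - 1"; cases "i = m - 1") auto
  qed
  also have "\<dots> = X $$ (i, j)" using ij by simp
  finally show "(u * X) $$ (i, j) = X $$ (i, j)" .
qed (use std_unipotent_GL[OF u, THEN GL_carrier] m X in auto)

definition trace_op ::
  "('k::{field,finite} \<Rightarrow> 'r::field) \<Rightarrow> ('k, 'r, 'v::ab_group_add) rep \<Rightarrow> 'k mat \<Rightarrow> 'v \<Rightarrow> 'v" where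
  "trace_op \<chi> \<rho> g v = (\<Sum>t\<in>GL (rdeg \<rho>). rscale \<rho> (\<chi> (mtrace (g * t))) (ract \<rho> t v))"

lemma trace_op_linear:
  assumes "is_rep (\<rho> :: ('k::{field,finite}, 'r::field, 'v::ab_group_add) rep)"
  shows "linear_between (rscale \<rho>) (rspace \<rho>) (rscale \<rho>) (trace_op \<chi> \<rho> g)"
proof -
  interpret vector_space "rscale \<rho>" using is_rep_vs[OF assms] .
  note lin = is_rep_lin[OF assms]
  show ?thesis
    unfolding linear_between_def trace_op_def scale_sum_right sum.distrib[symmetric]
    by (intro conjI ballI allI sum.cong refl)
      (simp_all add: linear_between_add[OF lin] linear_between_scale[OF lin] scale_right_distrib mult.commute)
qed

text \<open>The image of a singular \<open>g\<close> lies in a hyperplane, whose stabiliser has a unipotent radical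
  \<open>N\<close> fixing \<open>g\<close> from the left; hence the operator factors through the \<open>N\<close>-coinvariants.\<close>

lemma trace_op_cuspidal_zero:
  fixes \<sigma> :: "('k::{field,finite}, 'r::field, 'v::ab_group_add) rep"
  assumes \<sigma>: "cuspidal \<sigma>" and m: "2 \<le> rdeg \<sigma>"
    and g: "g \<in> carrier_mat (rdeg \<sigma>) (rdeg \<sigma>)" "g \<notin> GL (rdeg \<sigma>)" and v: "v \<in> rspace \<sigma>"
  shows "trace_op \<chi> \<sigma> g v = 0"
proof -
  have \<rho>: "is_rep \<sigma>" using \<sigma> by (auto simp: cuspidal_def irreducible_rep_def)
  interpret vector_space "rscale \<sigma>" using is_rep_vs[OF \<rho>] .
  note V = is_rep_subspace[OF \<rho>] and lin = trace_op_linear[OF \<rho>, of \<chi> g]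
  let ?m = "rdeg \<sigma>"
  obtain P where P: "P \<in> GL ?m" "\<And>j. j < ?m \<Longrightarrow> (P * g) $$ (?m - 1, j) = 0"
    using singular_decomposition[OF g] by metis
  let ?h = "GLinv ?m P"
  \<comment> \<open>Conjugation by the inverse of \<open>P\<close> returns from the standard
    hyperplane to one containing the image of \<open>g\<close>.\<close>
  let ?N = "(\<lambda>u. ?h * u * GLinv ?m ?h) ` std_unipotent [?m - 1, 1]"
  have inv_h: "GLinv ?m ?h = P" using P(1) by simp
  have ns: "sum_list [?m - 1, 1] = ?m" using m by simp
  have NU: "?N \<in> unipotent_radicals ?m"
    unfolding unipotent_radicals_def using m P(1)
    by (intro CollectI exI[of _ "[?m - 1, 1]"] exI[of _ ?h]) auto
  have NG: "n \<in> GL ?m" and Ng: "n * g = g" if "n \<in> ?N" for n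
  proof -
    obtain u where u: "u \<in> std_unipotent [?m - 1, 1]" "n = ?h * u * P"
      using \<open>n \<in> ?N\<close> unfolding inv_h by blast
    have uG: "u \<in> GL ?m" using std_unipotent_GL[OF u(1)] unfolding ns .
    show "n \<in> GL ?m" using u uG P(1) by simp
    note c = GL_carrier[OF P(1)] GL_carrier[OF uG] GL_carrier[OF GLinv_closed[OF P(1)]]
    have "n * g = ?h * (u * (P * g))"
      using c g(1) unfolding u(2) by (simp add: assoc_mult_mat[of _ ?m ?m _ ?m _ ?m])
    also have "u * (P * g) = P * g"
      by (rule unipotent_fixes[OF u(1) m]) (use P(2) c g(1) in auto)
    finally show "n * g = g" using GL_cancel[OF P(1) g(1)] by simp
  qed
  have kill: "trace_op \<chi> \<sigma> g (ract \<sigma> n x) = trace_op \<chi> \<sigma> g x" if n: "n \<in> ?N" and x: "x \<in> rspace \<sigma>" for n x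
  proof -
    have "trace_op \<chi> \<sigma> g (ract \<sigma> n x) =
        (\<Sum>t\<in>GL ?m. rscale \<sigma> (\<chi> (mtrace (g * (t * n)))) (ract \<sigma> (t * n) x))"
      unfolding trace_op_def
    proof (intro sum.cong refl)
      fix t :: "'k mat" assume t: "t \<in> GL ?m"
      note c = GL_carrier[OF t] GL_carrier[OF NG[OF n]]
      have "mtrace (g * (t * n)) = mtrace (g * t * n)"
        using c g(1) by (simp add: assoc_mult_mat[of _ ?m ?m _ ?m _ ?m])
      also have "\<dots> = mtrace (n * (g * t))" using c g(1) by (intro mtrace_comm) auto
      also have "n * (g * t) = g * t"
        using c g(1) Ng[OF n] by (simp add: assoc_mult_mat[of _ ?m ?m _ ?m _ ?m, symmetric])
      finally show "rscale \<sigma> (\<chi> (mtrace (g * t))) (ract \<sigma> t (ract \<sigma> n x)) =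
          rscale \<sigma> (\<chi> (mtrace (g * (t * n)))) (ract \<sigma> (t * n) x)"
        using is_rep_mult[OF \<rho> t NG[OF n] x] by simp
    qed
    also have "\<dots> = trace_op \<chi> \<sigma> g x"
      unfolding trace_op_def by (rule sum_GL_right[OF NG[OF n]])
    finally show ?thesis .
  qed
  have ker: "x \<in> rspace \<sigma> \<and> trace_op \<chi> \<sigma> g x = 0" if "x \<in> coinv_kernel \<sigma> ?N" for x
    using that unfolding coinv_kernel_def
  proof (induction rule: span_induct_alt)
    case base
    show ?case using linear_between_zero[OF lin] subspace_0[OF V] by simp
  next
    case (step c x y)
    from step(1) obtain n w where nw: "n \<in> ?N" "w \<in> rspace \<sigma>" "x = ract \<sigma> n w - w"
      unfolding mem_Collect_eq by (elim exE conjE) (rule that, assumption+)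
    have nwV: "ract \<sigma> n w \<in> rspace \<sigma>" using is_rep_act[OF \<rho> NG[OF nw(1)] nw(2)] .
    have xV: "x \<in> rspace \<sigma>" using subspace_diff[OF V nwV nw(2)] nw(3) by simp
    have "trace_op \<chi> \<sigma> g (x + w) = trace_op \<chi> \<sigma> g w" using kill[OF nw(1,2)] nw(3) by simp
    then have "trace_op \<chi> \<sigma> g x = 0" using linear_between_add[OF lin xV nw(2)] by simp
    then show ?case
      using linear_between_add[OF lin subspace_scale[OF V xV], of y c] linear_between_scale[OF lin xV] step
        subspace_add[OF V subspace_scale[OF V xV]] by simp
  qed
  \<comment> \<open>Cuspidality makes the coset of \<open>v\<close> equal to the kernel, and the
    kernel contains 0, so \<open>v\<close> lies in it, where the operator vanishes.\<close>
  have "coinvariants \<sigma> ?N = {coinv_kernel \<sigma> ?N}" 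
    using \<sigma> NU unfolding cuspidal_def by (elim conjE bspec)
  moreover have "(+) v ` coinv_kernel \<sigma> ?N \<in> coinvariants \<sigma> ?N"
    unfolding coinvariants_def using v by (rule imageI)
  ultimately have eq: "(+) v ` coinv_kernel \<sigma> ?N = coinv_kernel \<sigma> ?N" by (simp only: singleton_iff)
  have "0 \<in> coinv_kernel \<sigma> ?N" unfolding coinv_kernel_def by (rule span_zero)
  then have "v + 0 \<in> (+) v ` coinv_kernel \<sigma> ?N" by (rule imageI)
  then have "v \<in> coinv_kernel \<sigma> ?N" unfolding eq by simp
  from ker[OF this] show ?thesis ..
qed

text \<open>Under a trivial action each line is invariant, so the whole space is one line, and its
  coordinate is the isomorphism.\<close>

lemma irreducible_trivial_action:
  fixes \<sigma> :: "('k::field, 'r::field, 'v::ab_group_add) rep"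
  assumes irr: "irreducible_rep \<sigma>" and deg: "rdeg \<sigma> = 1"
    and fix_: "\<And>h v. h \<in> GL 1 \<Longrightarrow> v \<in> rspace \<sigma> \<Longrightarrow> ract \<sigma> h v = v"
  shows "rep_iso \<sigma> (triv_rep :: ('k, 'r, 'r) rep)"
proof -
  have \<rho>: "is_rep \<sigma>" using irr by (auto simp: irreducible_rep_def)
  interpret vector_space "rscale \<sigma>" using is_rep_vs[OF \<rho>] .
  note V = is_rep_subspace[OF \<rho>]
  obtain w where w: "w \<in> rspace \<sigma>" "w \<noteq> 0"
    using irr subspace_0[OF V] by (auto simp: irreducible_rep_def)
  let ?i = "\<lambda>a. rscale \<sigma> a w"
  have "invariant_subspace \<sigma> (range ?i)"
    unfolding invariant_subspace_def deg
  proof (intro conjI ballI)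
    show "subspace (range ?i)"
      by (intro subspaceI) (auto simp: image_iff scale_left_distrib[symmetric] intro: exI[of _ 0])
    show "range ?i \<subseteq> rspace \<sigma>" using subspace_scale[OF V w(1)] by auto
    then show "ract \<sigma> h ` range ?i \<subseteq> range ?i" if "h \<in> GL 1" for h using fix_[OF that] by auto
  qed
  moreover have "w \<in> range ?i" by (rule range_eqI[of _ _ 1]) simp
  ultimately have ran: "range ?i = rspace \<sigma>" using irr w unfolding irreducible_rep_def by blast
  have inj: "inj ?i" using w by (auto intro: injI)
  let ?f = "inv_into UNIV ?i"
  have fi: "?f (?i a) = a" for a using inj by (rule inv_f_f)
  have "rep_hom_on \<sigma> (rspace \<sigma>) (triv_rep :: ('k, 'r, 'r) rep) ?f"
    unfolding rep_hom_on_def linear_between_def ran[symmetric] triv_rep_def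
  proof (intro conjI ballI allI)
    fix x y assume "x \<in> range ?i" "y \<in> range ?i"
    then show "?f (x + y) = ?f x + ?f y" by (auto simp: scale_left_distrib[symmetric] fi)
  next
    fix a x assume "x \<in> range ?i"
    then show "?f (rscale \<sigma> a x) = rscale \<lparr>rdeg = 1, rscale = (*), rspace = UNIV, ract = \<lambda>g v. v\<rparr> a (?f x)"
      by (auto simp: fi)
  next
    fix h :: "'k mat" and x assume "h \<in> GL (rdeg \<sigma>)" "x \<in> range ?i"
    then show "?f (ract \<sigma> h x) = ract \<lparr>rdeg = 1, rscale = (*), rspace = UNIV, ract = \<lambda>g v. v\<rparr> h (?f x)"
      using fix_[of h x] deg ran by simp
  qed simp
  moreover have "bij_betw ?f (rspace \<sigma>) UNIV"
    unfolding ran[symmetric] by (rule bij_betw_byWitness[where f' = ?i]) (auto simp: fi)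
  ultimately show ?thesis
    unfolding rep_iso_def using deg by (auto simp: triv_rep_def)
qed

text \<open>In degree one there is no proper parabolic subgroup and cuspidality gives no
  information. The only singular matrix is 0, and the operator becomes the sum of all
  \<open>\<sigma> t\<close>, whose values are fixed by the group. A nonzero fixed vector would make
  \<open>\<sigma>\<close> trivial; this is where the exclusion of 1 is used.\<close>

lemma trace_op_degree_one_zero:
  fixes \<sigma> :: "('k::{field,finite}, 'r::field, 'v::ab_group_add) rep"
  assumes irr: "irreducible_rep \<sigma>" and deg: "rdeg \<sigma> = 1"
    and nontriv: "\<not> rep_iso \<sigma> (triv_rep :: ('k, 'r, 'r) rep)" and \<chi>: "additive_character \<chi>"
    and g: "g \<in> carrier_mat 1 1" "g \<notin> GL 1" and v: "v \<in> rspace \<sigma>"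
  shows "trace_op \<chi> \<sigma> g v = 0"
proof (rule ccontr)
  assume nz: "trace_op \<chi> \<sigma> g v \<noteq> 0"
  have \<rho>: "is_rep \<sigma>" using irr by (auto simp: irreducible_rep_def)
  interpret vector_space "rscale \<sigma>" using is_rep_vs[OF \<rho>] .
  note V = is_rep_subspace[OF \<rho>]
  let ?w = "trace_op \<chi> \<sigma> g v"
  have g0: "g = 0\<^sub>m 1 1" by (rule singular_one[OF g])
  have weq: "?w = (\<Sum>t\<in>GL 1. rscale \<sigma> 1 (ract \<sigma> t v))"
    unfolding trace_op_def deg
  proof (intro sum.cong refl)
    fix t :: "'k mat" assume "t \<in> GL 1"
    then have "g * t = 0\<^sub>m 1 1" unfolding g0 by (metis GL_carrier left_mult_zero_mat)
    then show "rscale \<sigma> (\<chi> (mtrace (g * t))) (ract \<sigma> t v) = rscale \<sigma> 1 (ract \<sigma> t v)"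
      by (simp add: mtrace_def additive_character_zero[OF \<chi>])
  qed
  have wV: "?w \<in> rspace \<sigma>"
    unfolding weq by (intro subspace_sum[OF V] subspace_scale[OF V] is_rep_act[OF \<rho>]) (auto simp: deg v)
  have wfix: "ract \<sigma> h ?w = ?w" if h: "h \<in> GL 1" for h
  proof -
    have "ract \<sigma> h ?w = (\<Sum>t\<in>GL 1. rscale \<sigma> 1 (ract \<sigma> h (ract \<sigma> t v)))"
      unfolding weq
      by (rule linear_between_sum[OF is_rep_vs[OF \<rho>] V is_rep_lin[OF \<rho>]])
        (use h v is_rep_act[OF \<rho>] deg in auto)
    also have "\<dots> = (\<Sum>t\<in>GL 1. rscale \<sigma> 1 (ract \<sigma> (h * t) v))"
      using is_rep_mult[OF \<rho>, unfolded deg] h v by (intro sum.cong) auto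
    also have "\<dots> = ?w" unfolding weq by (rule sum_GL_left[OF h])
    finally show ?thesis .
  qed
  define F where "F = {x \<in> rspace \<sigma>. \<forall>h\<in>GL 1. ract \<sigma> h x = x}"
  have "invariant_subspace \<sigma> F"
    unfolding invariant_subspace_def deg
  proof (intro conjI ballI)
    have lin: "linear_between (rscale \<sigma>) (rspace \<sigma>) (rscale \<sigma>) (ract \<sigma> h)" if "h \<in> GL 1" for h
      using is_rep_lin[OF \<rho>] that deg by simp
    show "subspace F"
      unfolding F_def
      using linear_between_zero[OF lin subspace_0[OF V]] linear_between_add[OF lin] linear_between_scale[OF lin]
        subspace_0[OF V] subspace_add[OF V] subspace_scale[OF V]
      by (intro subspaceI) auto
    show "ract \<sigma> h ` F \<subseteq> F" if "h \<in> GL 1" for h using that by (auto simp: F_def)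
  qed (auto simp: F_def)
  then have "F = {0} \<or> F = rspace \<sigma>" using irr by (simp add: irreducible_rep_def)
  moreover have "?w \<in> F" using wV wfix by (simp add: F_def)
  then have "F \<noteq> {0}" using nz by blast
  ultimately have "F = rspace \<sigma>" by simp
  then have "rep_iso \<sigma> (triv_rep :: ('k, 'r, 'r) rep)"
    by (intro irreducible_trivial_action[OF irr deg]) (auto simp: F_def)
  then show False using nontriv by contradiction
qed

text \<open>Both scalars belong to operators on \<open>\<sigma>\<close> itself, so their product is
  obtained by composing the two sums on one vector. The scalar \<open>d\<close> will serve for the
  dual.\<close>

lemma cuspidal_gauss_product:
  fixes \<sigma> :: "('k::{field,finite}, 'r::field, 'v::ab_group_add) rep"
  assumes \<psi>: "additive_character \<psi>" "\<exists>x. \<psi> x \<noteq> 1"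
    and \<sigma>: "cuspidal \<sigma>" "\<not> rep_iso \<sigma> (triv_rep :: ('k, 'r, 'r) rep)"
    and c: "gauss_scalar \<psi> True \<sigma> c" and d: "gauss_scalar (\<lambda>x. inverse (\<psi> x)) False \<sigma> d"
  shows "c * d = of_nat (CARD('k)) ^ (rdeg \<sigma>)\<^sup>2"
proof -
  have irr: "irreducible_rep \<sigma>" using \<sigma> by (auto simp: cuspidal_def)
  have \<rho>: "is_rep \<sigma>" using irr by (auto simp: irreducible_rep_def)
  interpret vector_space "rscale \<sigma>" using is_rep_vs[OF \<rho>] .
  note V = is_rep_subspace[OF \<rho>]
  let ?m = "rdeg \<sigma>" and ?\<chi> = "\<lambda>x. inverse (\<psi> x)" and ?s = "rscale \<sigma>"
  let ?M = "carrier_mat ?m ?m :: 'k mat set"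
  have \<chi>: "additive_character ?\<chi>" by (rule additive_character_inverse[OF \<psi>(1)])
  have nz\<psi>: "\<psi> x \<noteq> 0" for x using \<psi>(1) by (simp add: additive_character_def)
  obtain v where v: "v \<in> rspace \<sigma>" "v \<noteq> 0"
    using irr subspace_0[OF V] by (auto simp: irreducible_rep_def)
  have sing: "trace_op ?\<chi> \<sigma> g v = 0" if "g \<in> ?M" "g \<notin> GL ?m" for g
  \<comment> \<open>From degree two on cuspidality kills singular matrices; in degree one it is the
    non-triviality of \<sigma>.\<close>
  proof (cases "2 \<le> ?m")
    case True
    then show ?thesis by (rule trace_op_cuspidal_zero[OF \<sigma>(1) _ that v(1)])
  next
    case False
    then have "?m = 1" using \<sigma>(1) by (auto simp: cuspidal_def)
    then show ?thesis using trace_op_degree_one_zero[OF irr _ \<sigma>(2) \<chi> _ _ v(1)] that by simp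
  qed
  let ?D = "gauss_op ?\<chi> False \<sigma> v"
  \<comment> \<open>Writing h = g t confines g to the character and so gives a formula that extends
    to singular g.\<close>
  have Dt: "ract \<sigma> (GLinv ?m g) ?D = trace_op ?\<chi> \<sigma> g v" if g: "g \<in> GL ?m" for g
  proof -
    have gi: "GLinv ?m g \<in> GL ?m" using g by simp
    have "ract \<sigma> (GLinv ?m g) ?D = (\<Sum>h\<in>GL ?m. ?s (?\<chi> (mtrace h)) (ract \<sigma> (GLinv ?m g) (ract \<sigma> h v)))"
      unfolding gauss_op_def gpow_def if_False
      by (rule linear_between_sum[OF is_rep_vs[OF \<rho>] V is_rep_lin[OF \<rho> gi]]) (simp add: is_rep_act[OF \<rho>] v)
    also have "\<dots> = (\<Sum>h\<in>GL ?m. ?s (?\<chi> (mtrace (g * (GLinv ?m g * h)))) (ract \<sigma> (GLinv ?m g * h) v))"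
    proof (intro sum.cong refl)
      fix h :: "'k mat" assume h: "h \<in> GL ?m"
      have "g * (GLinv ?m g * h) = h" using GL_cancel[OF gi GL_carrier[OF h]] g by simp
      then show "?s (?\<chi> (mtrace h)) (ract \<sigma> (GLinv ?m g) (ract \<sigma> h v)) =
          ?s (?\<chi> (mtrace (g * (GLinv ?m g * h)))) (ract \<sigma> (GLinv ?m g * h) v)"
        using is_rep_mult[OF \<rho> gi h v(1)] by simp
    qed
    also have "\<dots> = trace_op ?\<chi> \<sigma> g v" unfolding trace_op_def by (rule sum_GL_left[OF gi])
    finally show ?thesis .
  qed
  have "?s (c * d) v = gauss_op \<psi> True \<sigma> ?D"
    using c d v(1) gauss_op_closed[OF \<rho> v(1), of ?\<chi> False] by (simp add: gauss_scalar_def)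
  also have "\<dots> = (\<Sum>g\<in>GL ?m. ?s (\<psi> (mtrace g)) (trace_op ?\<chi> \<sigma> g v))"
    unfolding gauss_op_def[of \<psi>] gpow_def if_True by (intro sum.cong refl) (simp add: Dt)
  also have "\<dots> = (\<Sum>g\<in>?M. ?s (\<psi> (mtrace g)) (trace_op ?\<chi> \<sigma> g v))"
    by (rule sum.mono_neutral_left) (auto simp: sing)
  also have "\<dots> = (\<Sum>t\<in>GL ?m. ?s (\<Sum>g\<in>?M. \<psi> (mtrace g) * ?\<chi> (mtrace (g * t))) (ract \<sigma> t v))"
    unfolding trace_op_def scale_sum_right scale_sum_left by (subst sum.swap) simp
  also have "\<dots> = (\<Sum>t\<in>GL ?m. if t = (1\<^sub>m ?m :: 'k mat) then ?s (of_nat (CARD('k)) ^ ?m\<^sup>2) v else 0)"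
  proof (intro sum.cong refl)
    fix t :: "'k mat" assume t: "t \<in> GL ?m"
    note tc = GL_carrier[OF t]
    let ?A = "1\<^sub>m ?m - t"
    have A: "?A \<in> ?M" using minus_carrier_mat[OF tc] .
    have "(\<Sum>g\<in>?M. \<psi> (mtrace g) * ?\<chi> (mtrace (g * t))) = (\<Sum>g\<in>?M. \<psi> (mtrace (g * ?A)))"
    proof (intro sum.cong refl)
      fix g :: "'k mat" assume g: "g \<in> ?M"
      have "g * ?A + g * t = g"
        using g tc unfolding mult_minus_distrib_mat[OF g one_carrier_mat tc] right_mult_one_mat[OF g]
        by (intro eq_matI) auto
      then have "mtrace g = mtrace (g * ?A) + mtrace (g * t)"
        using mtrace_add[of "g * ?A" ?m "g * t"] g tc A by simp
      then show "\<psi> (mtrace g) * ?\<chi> (mtrace (g * t)) = \<psi> (mtrace (g * ?A))"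
        by (simp add: additive_character_add[OF \<psi>(1)] nz\<psi>)
    qed
    also have "\<dots> = (if \<forall>(i, j)\<in>{..<?m} \<times> {..<?m}. ?A $$ (j, i) = 0 then of_nat (CARD('k)) ^ ?m\<^sup>2 else 0)"
      using mats_on_character_sum[OF \<psi> subset_refl A] by (simp add: mats_on_full power2_eq_square)
    also have "(\<forall>(i, j)\<in>{..<?m} \<times> {..<?m}. ?A $$ (j, i) = 0) \<longleftrightarrow> t = 1\<^sub>m ?m"
    proof
      assume *: "\<forall>(i, j)\<in>{..<?m} \<times> {..<?m}. ?A $$ (j, i) = 0"
      show "t = 1\<^sub>m ?m"
      proof (rule eq_matI)
        fix i j assume "i < dim_row (1\<^sub>m ?m :: 'k mat)" "j < dim_col (1\<^sub>m ?m :: 'k mat)"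
        then show "t $$ (i, j) = 1\<^sub>m ?m $$ (i, j)" using * tc by auto
      qed (use tc in auto)
    qed auto
    finally show "?s (\<Sum>g\<in>?M. \<psi> (mtrace g) * ?\<chi> (mtrace (g * t))) (ract \<sigma> t v) =
        (if t = 1\<^sub>m ?m then ?s (of_nat (CARD('k)) ^ ?m\<^sup>2) v else 0)"
      using is_rep_one[OF \<rho> v(1)] by simp
  qed
  also have "\<dots> = ?s (of_nat (CARD('k)) ^ ?m\<^sup>2) v" by simp
  finally show ?thesis using v(2) scale_right_imp_eq by blast
qed

section \<open>The trivial representation\<close>

text \<open>The character sums to 0 over all 1 by 1 matrices, and the zero matrix accounts for 1 of
  it; the group is left with - 1, the origin of the sign in the theorem.\<close>

lemma gauss_scalar_trivial:
  fixes \<rho> :: "('k::{field,finite}, 'r::field, 'v::ab_group_add) rep"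
  assumes \<chi>: "additive_character \<chi>" "\<exists>x. \<chi> x \<noteq> 1"
    and \<rho>: "is_rep \<rho>" and iso: "rep_iso \<rho> (triv_rep :: ('k, 'r, 'r) rep)"
  shows "rdeg \<rho> = 1" "gauss_scalar \<chi> b \<rho> (- 1)"
proof -
  show deg: "rdeg \<rho> = 1" using iso by (simp add: rep_iso_def triv_rep_def)
  interpret vector_space "rscale \<rho>" using is_rep_vs[OF \<rho>] .
  obtain f where f: "rep_hom_on \<rho> (rspace \<rho>) (triv_rep :: ('k, 'r, 'r) rep) f" "inj_on f (rspace \<rho>)"
    using iso by (auto simp: rep_iso_def bij_betw_def)
  have fix_: "ract \<rho> g v = v" if "g \<in> GL 1" "v \<in> rspace \<rho>" for g v
  proof -
    have "f (ract \<rho> g v) = f v" using f(1) that deg by (simp add: rep_hom_on_def triv_rep_def)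
    then show ?thesis using inj_onD[OF f(2)] is_rep_act[OF \<rho>] that deg by simp
  qed
  have "(\<Sum>g\<in>carrier_mat 1 1. \<chi> (mtrace (g :: 'k mat))) = 0"
  proof -
    have "(\<Sum>g\<in>mats_on 1 ({..<1} \<times> {..<1}). \<chi> (mtrace (g * 1\<^sub>m 1))) = 0"
      by (subst mats_on_character_sum[OF \<chi>]) auto
    moreover have "g * 1\<^sub>m 1 = g" if "g \<in> carrier_mat 1 1" for g :: "'k mat"
      using that by simp
    ultimately show ?thesis unfolding mats_on_full by (simp cong: sum.cong)
  qed
  moreover have "carrier_mat 1 1 = insert (0\<^sub>m 1 1) (GL 1 :: 'k mat set)"
    using singular_one by auto
  moreover have "0\<^sub>m 1 1 \<notin> (GL 1 :: 'k mat set)"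
    by (simp add: GL_iff del: GL_carrier)
  moreover have "mtrace (0\<^sub>m 1 1 :: 'k mat) = 0" by (simp add: mtrace_def)
  ultimately have "1 + (\<Sum>g\<in>GL 1. \<chi> (mtrace (g :: 'k mat))) = 0"
    using additive_character_zero[OF \<chi>(1)] by simp
  then have sum: "(\<Sum>g\<in>GL 1. \<chi> (mtrace (g :: 'k mat))) = - 1"
    by (metis add.commute eq_neg_iff_add_eq_0)
  show "gauss_scalar \<chi> b \<rho> (- 1)"
    unfolding gauss_scalar_def gauss_op_def deg sum[symmetric] scale_sum_left
    by (intro ballI sum.cong refl) (simp add: fix_)
qed

section \<open>The characteristic and the cardinality of a finite field\<close>

text \<open>A Sylow subgroup of order \<open>l\<close> of the additive group provides a nonzero element annihilated
  by \<open>l\<close>.\<close>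

lemma of_nat_prime_dvd_card:
  assumes "prime l" "l dvd CARD('k::{field,finite})"
  shows "of_nat l = (0::'k)"
proof -
  define G where "G = \<lparr>carrier = UNIV :: 'k set, mult = (+), one = (0 :: 'k)\<rparr>"
  have G: "group G"
    by (rule groupI) (auto simp: G_def add.assoc intro: left_minus)
  obtain n where n: "CARD('k) = l * n" using assms(2) by blast
  have "order G = l ^ 1 * n" using n by (simp add: order_def G_def)
  then obtain H where H: "subgroup H G" "card H = l ^ 1"
    using sylow_thm[OF assms(1) G, of 1 n] by (auto simp: G_def)
  have add: "x + y \<in> H" if "x \<in> H" "y \<in> H" for x y
    using subgroup.m_closed[OF H(1) that] by (simp add: G_def)
  have fin: "finite H" by simp
  have "\<not> H \<subseteq> {0}" using H(2) prime_gt_1_nat[OF assms(1)] card_mono[of "{0}" H] by auto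
  then obtain x where x: "x \<in> H" "x \<noteq> 0" by blast
  \<comment> \<open>Translation by \<open>x\<close> permutes \<open>H\<close>, so the sum over
    \<open>H\<close> does not change; yet it grows by \<open>l\<close> times
    \<open>x\<close>.\<close>
  have "(\<lambda>h. x + h) ` H = H"
    by (rule endo_inj_surj[OF fin]) (auto simp: add x)
  then have "(\<Sum>h\<in>H. h) = (\<Sum>h\<in>(\<lambda>h. x + h) ` H. h)" by simp
  also have "\<dots> = (\<Sum>h\<in>H. x + h)" by (subst sum.reindex) auto
  also have "\<dots> = of_nat l * x + (\<Sum>h\<in>H. h)" using H(2) by (simp add: sum.distrib)
  finally show ?thesis using x(2) by simp
qed

text \<open>If the cardinality vanished in \<open>'r\<close>, the characteristic of
  \<open>'r\<close> would be a prime dividing it, hence zero in \<open>'k\<close>, and the two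
  characteristics would agree.\<close>

lemma of_nat_card_nonzero:
  assumes "CHAR('r::field) \<noteq> CHAR('k::{field,finite})"
  shows "of_nat (CARD('k)) \<noteq> (0::'r)"
proof
  assume "of_nat (CARD('k)) = (0::'r)"
  then have dvd: "CHAR('r) dvd CARD('k)" by (simp add: of_nat_eq_0_iff_char_dvd)
  then have "CHAR('r) > 0" by (metis dvd_0_left_iff finite_UNIV_card_ge_0 finite_class.finite_UNIV neq0_conv)
  then have pr: "prime CHAR('r)" by (rule prime_CHAR_semidom)
  from of_nat_prime_dvd_card[OF pr dvd] have "CHAR('k) dvd CHAR('r)"
    by (simp add: of_nat_eq_0_iff_char_dvd)
  moreover have "CHAR('k) \<noteq> 1" by simp
  ultimately show False using pr assms by (metis prime_nat_iff)
qed

section \<open>Dual representations\<close>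

lemma dual_rep_simps [simp]:
  "rdeg (dual_rep \<rho>) = rdeg \<rho>"
  "rscale (dual_rep \<rho>) = (\<lambda>a \<phi> v. a * \<phi> v)"
  "ract (dual_rep \<rho>) = (\<lambda>g \<phi> v. if v \<in> rspace \<rho> then \<phi> (ract \<rho> (GLinv (rdeg \<rho>) g) v) else 0)"
  by (simp_all add: dual_rep_def)

lemma in_rspace_dual:
  "\<phi> \<in> rspace (dual_rep \<rho>) \<longleftrightarrow>
    linear_between (rscale \<rho>) (rspace \<rho>) (*) \<phi> \<and> (\<forall>v. v \<notin> rspace \<rho> \<longrightarrow> \<phi> v = 0)"
  by (simp add: dual_rep_def)

lemma is_rep_dual:
  fixes \<rho> :: "('k::field, 'r::field, 'v::ab_group_add) rep"
  assumes \<rho>: "is_rep \<rho>"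
  shows "is_rep (dual_rep \<rho>)"
proof -
  interpret D: vector_space "\<lambda>a (\<theta> :: 'v \<Rightarrow> 'r) \<beta>. a * \<theta> \<beta>" by (rule vector_space_fun1)
  have act: "(\<lambda>v. if v \<in> rspace \<rho> then \<phi> (ract \<rho> (GLinv (rdeg \<rho>) g) v) else 0) \<in> rspace (dual_rep \<rho>)"
    if g: "g \<in> GL (rdeg \<rho>)" and \<phi>: "\<phi> \<in> rspace (dual_rep \<rho>)" for g \<phi>
  proof -
    let ?a = "ract \<rho> (GLinv (rdeg \<rho>) g)"
    have gi: "GLinv (rdeg \<rho>) g \<in> GL (rdeg \<rho>)" using g by simp
    have "linear_between (rscale \<rho>) (rspace \<rho>) (*) \<phi>" using \<phi> by (simp add: in_rspace_dual)
    note l = linear_between_add[OF this] linear_between_scale[OF this]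
      linear_between_add[OF is_rep_lin[OF \<rho> gi]] linear_between_scale[OF is_rep_lin[OF \<rho> gi]]
    show ?thesis
      unfolding in_rspace_dual linear_between_def
      using l is_rep_act[OF \<rho> gi] is_rep_add[OF \<rho>] is_rep_scale[OF \<rho>] by simp
  qed
  show ?thesis
    unfolding is_rep_def dual_rep_simps
  proof (intro conjI ballI)
    show "D.subspace (rspace (dual_rep \<rho>))"
      by (intro D.subspaceI) (auto simp: in_rspace_dual linear_between_def algebra_simps)
  next
    fix g :: "'k mat" assume g: "g \<in> GL (rdeg \<rho>)"
    show "(\<lambda>\<phi> v. if v \<in> rspace \<rho> then \<phi> (ract \<rho> (GLinv (rdeg \<rho>) g) v) else 0) ` rspace (dual_rep \<rho>)
        \<subseteq> rspace (dual_rep \<rho>)"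
      using act[OF g] by blast
    show "linear_between (\<lambda>a \<phi> v. a * \<phi> v) (rspace (dual_rep \<rho>)) (\<lambda>a \<phi> v. a * \<phi> v)
        (\<lambda>\<phi> v. if v \<in> rspace \<rho> then \<phi> (ract \<rho> (GLinv (rdeg \<rho>) g) v) else 0)"
      by (auto simp: linear_between_def fun_eq_iff)
    fix h :: "'k mat" and \<phi> assume h: "h \<in> GL (rdeg \<rho>)"
    show "(\<lambda>v. if v \<in> rspace \<rho> then \<phi> (ract \<rho> (GLinv (rdeg \<rho>) (g * h)) v) else 0) =
        (\<lambda>v. if v \<in> rspace \<rho> then (if ract \<rho> (GLinv (rdeg \<rho>) g) v \<in> rspace \<rho>
          then \<phi> (ract \<rho> (GLinv (rdeg \<rho>) h) (ract \<rho> (GLinv (rdeg \<rho>) g) v)) else 0) else 0)"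
      using g h is_rep_act[OF \<rho>] is_rep_mult[OF \<rho>] by (auto simp: GLinv_mult)
  next
    fix \<phi> assume "\<phi> \<in> rspace (dual_rep \<rho>)"
    then show "(\<lambda>v. if v \<in> rspace \<rho> then \<phi> (ract \<rho> (GLinv (rdeg \<rho>) (1\<^sub>m (rdeg \<rho>))) v) else 0) = \<phi>"
      using is_rep_one[OF \<rho>] by (auto simp: in_rspace_dual)
  qed (rule vector_space_fun1)
qed

text \<open>Extension of {v} to a basis gives a functional in any dimension; it is cut off outside
  \<open>rspace \<rho>\<close> to respect the normalisation of \<open>dual_rep\<close>.\<close>

lemma exists_functional:
  fixes \<rho> :: "('k::field, 'r::field, 'v::ab_group_add) rep"
  assumes \<rho>: "is_rep \<rho>" and v: "v \<in> rspace \<rho>" "v \<noteq> 0"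
  obtains \<phi> where "\<phi> \<in> rspace (dual_rep \<rho>)" "\<phi> v = 1"
proof -
  have mv: "vector_space ((*) :: 'r \<Rightarrow> 'r \<Rightarrow> 'r)"
    by unfold_locales (auto simp: algebra_simps)
  interpret vector_space_pair "rscale \<rho>" "(*) :: 'r \<Rightarrow> 'r \<Rightarrow> 'r"
    using is_rep_vs[OF \<rho>] mv by (simp add: vector_space_pair_def)
  have "vs1.independent {v}" using v by simp
  from linear_independent_extend[OF this, of "\<lambda>_. 1"]
  obtain g where g: "Vector_Spaces.linear (rscale \<rho>) (*) g" "g v = 1" by auto
  have "(\<lambda>x. if x \<in> rspace \<rho> then g x else 0) \<in> rspace (dual_rep \<rho>)"
    using g(1) is_rep_add[OF \<rho>] is_rep_scale[OF \<rho>]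
    by (simp add: in_rspace_dual linear_between_def Vector_Spaces.linear_iff)
  then show thesis using that g(2) v(1) by simp
qed

text \<open>The inverse in the contragredient action cancels the inverse in the Gauss sum, so the
  operator on the dual is the transpose of the operator without inverses.\<close>

lemma gauss_scalar_dual:
  fixes \<rho> :: "('k::{field,finite}, 'r::field, 'v::ab_group_add) rep"
  assumes \<rho>: "is_rep \<rho>" and d: "gauss_scalar \<chi> False \<rho> d"
  shows "gauss_scalar \<chi> True (dual_rep \<rho>) d"
  unfolding gauss_scalar_def
proof (intro ballI ext)
  fix \<phi> v assume \<phi>: "\<phi> \<in> rspace (dual_rep \<rho>)"
  have lin: "linear_between (rscale \<rho>) (rspace \<rho>) (*) \<phi>" using \<phi> by (simp add: in_rspace_dual)
  show "gauss_op \<chi> True (dual_rep \<rho>) \<phi> v = rscale (dual_rep \<rho>) d \<phi> v"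
  proof (cases "v \<in> rspace \<rho>")
    case False
    then show ?thesis using \<phi> by (simp add: gauss_op_def sum_fun_apply in_rspace_dual)
  next
    case True
    then have "gauss_op \<chi> True (dual_rep \<rho>) \<phi> v = (\<Sum>g\<in>GL (rdeg \<rho>). \<chi> (mtrace g) * \<phi> (ract \<rho> g v))"
      by (simp add: gauss_op_def sum_fun_apply gpow_def)
    also have "\<dots> = \<phi> (gauss_op \<chi> False \<rho> v)"
      unfolding gauss_op_def gpow_def if_False
      by (rule linear_between_sum[OF is_rep_vs[OF \<rho>] is_rep_subspace[OF \<rho>] lin, symmetric])
        (simp add: is_rep_act[OF \<rho>] True)
    also have "\<dots> = d * \<phi> v"
      using d True linear_between_scale[OF lin True] by (simp add: gauss_scalar_def)
    finally show ?thesis by simp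
  qed
qed

section \<open>Gamma factors\<close>

text \<open>After the Fourier transform is expanded and the sums are exchanged, the inner sum for
  fixed h becomes, under the substitution of h g for g, the Gauss sum applied to h v.\<close>

lemma is_gamma_gauss_scalar:
  fixes \<rho> :: "('k::{field,finite}, 'r::field, 'v::ab_group_add) rep"
  assumes \<rho>: "is_rep \<rho>" and c: "gauss_scalar \<psi> True \<rho> c"
  shows "is_gamma s \<psi> \<rho> (inverse (s ^ (rdeg \<rho>)\<^sup>2) * c)"
  unfolding is_gamma_def
proof (intro ballI allI impI)
  fix v \<phi> and \<Phi> :: "'k mat \<Rightarrow> 'r"
  let ?m = "rdeg \<rho>"
  let ?S = "inverse (s ^ ?m\<^sup>2)"
  assume v: "v \<in> rspace \<rho>" and \<phi>: "\<phi> \<in> rspace (dual_rep \<rho>)"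
    and \<Phi>: "\<forall>g\<in>carrier_mat ?m ?m. g \<notin> GL ?m \<longrightarrow> \<Phi> g = 0"
  have lin: "linear_between (rscale \<rho>) (rspace \<rho>) (*) \<phi>" using \<phi> by (simp add: in_rspace_dual)
  have inner: "(\<Sum>g\<in>GL ?m. \<psi> (mtrace (h * g)) * \<phi> (ract \<rho> (GLinv ?m g) v)) = c * \<phi> (ract \<rho> h v)"
    if h: "h \<in> GL ?m" for h
  proof -
    have hv: "ract \<rho> h v \<in> rspace \<rho>" using is_rep_act[OF \<rho> h v] .
    have "(\<Sum>g\<in>GL ?m. \<psi> (mtrace (h * g)) * \<phi> (ract \<rho> (GLinv ?m g) v)) =
        (\<Sum>g\<in>GL ?m. \<psi> (mtrace (h * g)) * \<phi> (ract \<rho> (GLinv ?m (h * g)) (ract \<rho> h v)))"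
    proof (intro sum.cong refl)
      fix g :: "'k mat" assume g: "g \<in> GL ?m"
      have "ract \<rho> (GLinv ?m (h * g)) (ract \<rho> h v) = ract \<rho> (GLinv ?m (h * g) * h) v"
        using g h v by (intro is_rep_mult[OF \<rho>, symmetric]) auto
      also have "GLinv ?m (h * g) * h = GLinv ?m g"
        using g h by (simp add: GLinv_mult GL_assoc[where m = ?m])
      finally show "\<psi> (mtrace (h * g)) * \<phi> (ract \<rho> (GLinv ?m g) v) =
          \<psi> (mtrace (h * g)) * \<phi> (ract \<rho> (GLinv ?m (h * g)) (ract \<rho> h v))" by simp
    qed
    also have "\<dots> = (\<Sum>g\<in>GL ?m. \<psi> (mtrace g) * \<phi> (ract \<rho> (GLinv ?m g) (ract \<rho> h v)))"
      by (rule sum_GL_left[OF h])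
    also have "\<dots> = \<phi> (gauss_op \<psi> True \<rho> (ract \<rho> h v))"
      unfolding gauss_op_def gpow_def if_True
      by (rule linear_between_sum[OF is_rep_vs[OF \<rho>] is_rep_subspace[OF \<rho>] lin, symmetric])
        (simp add: is_rep_act[OF \<rho>] hv)
    also have "\<dots> = c * \<phi> (ract \<rho> h v)"
      using c hv linear_between_scale[OF lin hv] by (simp add: gauss_scalar_def)
    finally show ?thesis .
  qed
  have fourier: "fourier s \<psi> ?m \<Phi> g = ?S * (\<Sum>h\<in>GL ?m. \<Phi> h * \<psi> (mtrace (h * g)))" for g
    unfolding fourier_def
    by (intro arg_cong2[where f = "(*)"] refl sum.mono_neutral_right) (use \<Phi> in auto)
  have "(\<Sum>g\<in>GL ?m. fourier s \<psi> ?m \<Phi> g * \<phi> (ract \<rho> (GLinv ?m g) v)) =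
      (\<Sum>g\<in>GL ?m. \<Sum>h\<in>GL ?m. ?S * (\<Phi> h * (\<psi> (mtrace (h * g)) * \<phi> (ract \<rho> (GLinv ?m g) v))))"
    unfolding fourier sum_distrib_left sum_distrib_right by (simp add: mult_ac)
  also have "\<dots> = (\<Sum>h\<in>GL ?m. ?S * (\<Phi> h * (\<Sum>g\<in>GL ?m. \<psi> (mtrace (h * g)) * \<phi> (ract \<rho> (GLinv ?m g) v))))"
    unfolding sum_distrib_left by (rule sum.swap)
  also have "\<dots> = (\<Sum>h\<in>GL ?m. ?S * (\<Phi> h * (c * \<phi> (ract \<rho> h v))))"
    by (intro sum.cong refl) (simp add: inner)
  also have "\<dots> = ?S * c * (\<Sum>h\<in>GL ?m. \<Phi> h * \<phi> (ract \<rho> h v))"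
    unfolding sum_distrib_left by (simp add: mult_ac)
  finally show "(\<Sum>g\<in>GL ?m. fourier s \<psi> ?m \<Phi> g * \<phi> (ract \<rho> (GLinv ?m g) v)) =
      ?S * c * (\<Sum>g\<in>GL ?m. \<Phi> g * \<phi> (ract \<rho> g v))" .
qed

text \<open>Testing with the indicator function of the identity matrix and a functional with
  \<open>\<phi> v = 1\<close> reads off the constant.\<close>

lemma is_gamma_unique:
  fixes \<rho> :: "('k::{field,finite}, 'r::field, 'v::ab_group_add) rep"
  assumes \<rho>: "is_rep \<rho>" and nz: "rspace \<rho> \<noteq> {0}" and c: "is_gamma s \<psi> \<rho> c" and c': "is_gamma s \<psi> \<rho> c'"
  shows "c = c'"
proof -
  obtain v where v: "v \<in> rspace \<rho>" "v \<noteq> 0" using nz is_rep_zero[OF \<rho>] by auto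
  obtain \<phi> where \<phi>: "\<phi> \<in> rspace (dual_rep \<rho>)" "\<phi> v = 1" using exists_functional[OF \<rho> v] .
  let ?m = "rdeg \<rho>"
  let ?\<Phi> = "\<lambda>g :: 'k mat. if g = 1\<^sub>m ?m then 1 else 0 :: 'r"
  have supp: "?\<Phi> g = 0" if "g \<in> carrier_mat ?m ?m" "g \<notin> GL ?m" for g
    using that by auto
  have eq: "c * (\<Sum>g\<in>GL ?m. ?\<Phi> g * \<phi> (ract \<rho> g v)) = c' * (\<Sum>g\<in>GL ?m. ?\<Phi> g * \<phi> (ract \<rho> g v))"
    using trans[OF c[unfolded is_gamma_def, rule_format, OF v(1) \<phi>(1) supp, symmetric]
      c'[unfolded is_gamma_def, rule_format, OF v(1) \<phi>(1) supp]] .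
  have "(\<Sum>g\<in>GL ?m. ?\<Phi> g * \<phi> (ract \<rho> g v)) = (\<Sum>g\<in>GL ?m. if g = 1\<^sub>m ?m then \<phi> (ract \<rho> g v) else 0)"
    by (intro sum.cong) auto
  also have "\<dots> = 1" using \<phi>(2) is_rep_one[OF \<rho> v(1)] by simp
  finally show ?thesis using eq by simp
qed

lemma gamma_factor_gauss_scalar:
  fixes \<rho> :: "('k::{field,finite}, 'r::field, 'v::ab_group_add) rep"
  assumes \<rho>: "is_rep \<rho>" and nz: "rspace \<rho> \<noteq> {0}" and c: "gauss_scalar \<psi> True \<rho> c"
  shows "\<exists>!c. is_gamma s \<psi> \<rho> c" "gamma_factor s \<psi> \<rho> = inverse (s ^ (rdeg \<rho>)\<^sup>2) * c"
proof -
  note g = is_gamma_gauss_scalar[OF \<rho> c, of s]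
  show ex1: "\<exists>!c. is_gamma s \<psi> \<rho> c" using g is_gamma_unique[OF \<rho> nz] by blast
  show "gamma_factor s \<psi> \<rho> = inverse (s ^ (rdeg \<rho>)\<^sup>2) * c"
    unfolding gamma_factor_def using the1_equality[OF ex1 g] .
qed

section \<open>Nonvanishing of the first inducing factor\<close>

lemma tensor_space_zero:
  fixes \<rho>s :: "('k::field, 'r::field, 'v::ab_group_add) rep list"
  assumes "rspace \<rho> = {0}" "\<theta> \<in> tensor_space (\<rho> # \<rho>s)"
  shows "\<theta> = 0"
  using assms(2)
proof (induction rule: tensor_space_induct)
  case (step c xs \<theta>)
  then obtain ys where xs: "xs = 0 # ys" "ys \<in> tuples \<rho>s" using assms(1) by (auto simp: tuples_Cons)
  have "\<beta> xs = 0" if "multilinear_form (\<rho> # \<rho>s) \<beta>" for \<beta>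
    unfolding xs using linear_between_zero[OF multilinear_form_Cons(2)[OF that _ xs(2)]] assms(1) by simp
  then show ?case using step.IH by (simp add: pure_tensor_def fun_eq_iff)
qed simp

text \<open>Supplies the nonvanishing of \<open>\<pi>'\<close> that uniqueness of its gamma factor
  requires: a zero tensor factor would make the tensor product, the induced representation and its
  subquotient \<open>\<pi>\<close> zero.\<close>

lemma subquotient_par_ind_nonzero:
  fixes \<rho>s :: "('k::field, 'r::field, 'v::ab_group_add) rep list" and \<pi> :: "('k, 'r, 'u::ab_group_add) rep"
  assumes sq: "subquotient \<pi> (par_ind (\<rho> # \<rho>s))" and nz: "rspace \<pi> \<noteq> {0}" and zero: "0 \<in> rspace \<pi>"
  shows "rspace \<rho> \<noteq> {0}"
proof
  assume \<rho>: "rspace \<rho> = {0}"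
  let ?\<tau> = "par_ind (\<rho> # \<rho>s)"
  obtain U f where "invariant_subspace ?\<tau> U" and f: "f ` U = rspace \<pi>"
    using sq unfolding subquotient_def by blast
  then have U: "U \<subseteq> rspace ?\<tau>" by (simp add: invariant_subspace_def)
  have "F = 0" if "F \<in> rspace ?\<tau>" for F
  proof
    fix x
    have "F x = 0"
    proof (cases "x \<in> GL (sum_list (map rdeg (\<rho> # \<rho>s)))")
      case True
      then have "F x \<in> tensor_space (\<rho> # \<rho>s)" using that unfolding in_rspace_par_ind by blast
      then show ?thesis by (rule tensor_space_zero[OF \<rho>])
    next
      case False
      then show ?thesis using that unfolding in_rspace_par_ind by blast
    qed
    then show "F x = 0 x" by simp
  qed
  then have "U \<subseteq> {0}" using U by (simp add: subset_iff)
  then have "f ` U \<subseteq> f ` {0}" by (rule image_mono)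
  then have "rspace \<pi> \<subseteq> {f 0}" by (simp only: f image_insert image_empty)
  then show False using nz subset_singletonD[of "rspace \<pi>" "f 0"] zero by auto
qed

lemma prod_list_mult_power:
  fixes q :: "'r::field"
  assumes "\<And>x. x \<in> set xs \<Longrightarrow> f x * g x = q ^ n x"
  shows "prod_list (map f xs) * prod_list (map g xs) = q ^ sum_list (map n xs)"
  using assms
proof (induction xs)
  case (Cons x xs)
  have "prod_list (map f (x # xs)) * prod_list (map g (x # xs)) =
      (f x * g x) * (prod_list (map f xs) * prod_list (map g xs))" by (simp add: mult_ac)
  then show ?case using Cons by (simp add: power_add)
qed simp

lemma card_upper_pairs_list:
  "(sum_list ns)\<^sup>2 = sum_list (map (\<lambda>n. n\<^sup>2) ns) + 2 * card (upper_pairs ns)"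
  unfolding card_upper_pairs by (simp add: sum_list_sum_nth lessThan_atLeast0)

text \<open>The factors in the list for \<open>par_ind\<close> share one type of vectors, so 1
  enters as an isomorphic copy \<open>one\<close> on the type of \<open>\<pi>'\<close>. The unique
  existence claims give meaning to the definite descriptions in \<open>gamma_factor\<close>.\<close>

theorem proposition4p9:
  fixes s :: "'r::alg_closed_field"
    and \<psi> :: "'k::{field,finite} \<Rightarrow> 'r"
    and \<pi> :: "('k, 'r, 'u::ab_group_add) rep"
    and \<pi>' one :: "('k, 'r, 'v::ab_group_add) rep"
    and \<sigma>s :: "('k, 'r, 'w::ab_group_add) rep list"
    and k :: nat
  assumes "CHAR('r) \<noteq> CHAR('k)"
    and "s ^ 2 = of_nat (CARD('k))"
    and "additive_character \<psi>" and "\<exists>x. \<psi> x \<noteq> 1"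
    and "is_rep one" and "rep_iso one (triv_rep :: ('k, 'r, 'r) rep)"
    and "irreducible_rep \<pi>"
    and "is_rep \<pi>'"
    and "subquotient \<pi> (par_ind (\<pi>' # replicate k one))"
    and "\<forall>\<sigma>\<in>set \<sigma>s. cuspidal \<sigma> \<and> \<not> rep_iso \<sigma> (triv_rep :: ('k, 'r, 'r) rep)"
    and "subquotient \<pi>' (par_ind \<sigma>s)"
  shows "(\<exists>!c. is_gamma s \<psi> \<pi> c) \<and> (\<exists>!c. is_gamma s \<psi> \<pi>' c) \<and>
     (\<exists>!c. is_gamma s (\<lambda>x. inverse (\<psi> x)) (dual_rep \<pi>) c) \<and>
     gamma_factor s \<psi> \<pi> = (- inverse s) ^ k * gamma_factor s \<psi> \<pi>' \<and>
     gamma_factor s \<psi> \<pi> * gamma_factor s (\<lambda>x. inverse (\<psi> x)) (dual_rep \<pi>)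
       = inverse (of_nat (CARD('k)) ^ k)"
proof -
  note \<psi> = assms(3,4) and one = assms(5,6) and irr = assms(7) and \<pi>' = assms(8)
    and sq = assms(9) and \<sigma>s = assms(10) and sq' = assms(11)
  define q where "q = (of_nat (CARD('k)) :: 'r)"
  have q0: "of_nat (CARD('k)) \<noteq> (0::'r)" by (rule of_nat_card_nonzero[OF assms(1)])
  have sq2: "q = s\<^sup>2" using assms(2) by (simp add: q_def)
  have s0: "s \<noteq> 0" using q0 assms(2) by auto
  let ?\<chi> = "\<lambda>x. inverse (\<psi> x)"
  have \<chi>: "additive_character ?\<chi>" "\<exists>x. ?\<chi> x \<noteq> 1"
    using additive_character_inverse[OF \<psi>(1)] \<psi>(2) by auto
  have \<pi>: "is_rep \<pi>" "rspace \<pi> \<noteq> {0}" using irr by (auto simp: irreducible_rep_def)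
  have vs: "vector_space (rscale (par_ind \<rho>s))" for \<rho>s :: "('k, 'r, 'x::ab_group_add) rep list"
    unfolding rscale_par_ind by (rule vector_space_fun2)

  have "\<forall>\<sigma>\<in>set \<sigma>s. \<exists>p. gauss_scalar \<psi> True \<sigma> (fst p) \<and> gauss_scalar ?\<chi> False \<sigma> (snd p)"
    using \<sigma>s irreducible_gauss_scalar unfolding cuspidal_def by (metis fst_conv snd_conv)
  then obtain F where F: "\<And>\<sigma>. \<sigma> \<in> set \<sigma>s \<Longrightarrow> gauss_scalar \<psi> True \<sigma> (fst (F \<sigma>))"
    "\<And>\<sigma>. \<sigma> \<in> set \<sigma>s \<Longrightarrow> gauss_scalar ?\<chi> False \<sigma> (snd (F \<sigma>))" by metis
  let ?cs = "map (\<lambda>\<sigma>. fst (F \<sigma>)) \<sigma>s" and ?ds = "map (\<lambda>\<sigma>. snd (F \<sigma>)) \<sigma>s"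
  have cd: "prod_list ?cs * prod_list ?ds = q ^ sum_list (map (\<lambda>\<sigma>. (rdeg \<sigma>)\<^sup>2) \<sigma>s)"
    unfolding q_def by (rule prod_list_mult_power) (use cuspidal_gauss_product[OF \<psi>] \<sigma>s F in blast)
  have rep\<sigma>: "\<forall>\<sigma>\<in>set \<sigma>s. is_rep \<sigma>" using \<sigma>s by (auto simp: cuspidal_def irreducible_rep_def)

  define e' where "e' = card (upper_pairs (map rdeg \<sigma>s))"
  define C' where "C' = q ^ e' * prod_list ?cs"
  define D' where "D' = q ^ e' * prod_list ?ds"
  \<comment> \<open>\<open>\<pi>'\<close> need not be irreducible; its scalars are inherited from
    the representation induced from the cuspidal ones.\<close>
  have C': "gauss_scalar \<psi> True \<pi>' C'" unfolding C'_def e'_def q_def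
    by (intro gauss_scalar_subquotient[OF vs sq'] gauss_scalar_par_ind[OF \<psi> q0 _ rep\<sigma>])
      (simp add: list_all2_conv_all_nth F)
  have D': "gauss_scalar ?\<chi> False \<pi>' D'" unfolding D'_def e'_def q_def
    by (intro gauss_scalar_subquotient[OF vs sq'] gauss_scalar_par_ind[OF \<chi> q0 _ rep\<sigma>])
      (simp add: list_all2_conv_all_nth F)
  have deg': "rdeg \<pi>' = sum_list (map rdeg \<sigma>s)" using sq' by (simp add: subquotient_def)
  have "(rdeg \<pi>')\<^sup>2 = sum_list (map (\<lambda>\<sigma>. (rdeg \<sigma>)\<^sup>2) \<sigma>s) + 2 * e'"
    unfolding deg' card_upper_pairs_list e'_def by (simp add: comp_def)
  moreover have "C' * D' = q ^ e' * q ^ e' * (prod_list ?cs * prod_list ?ds)"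
    by (simp add: C'_def D'_def mult_ac)
  \<comment> \<open>\<open>C'\<close> and \<open>D'\<close> each carry one order of the unipotent
    radical, and together these supply the exponent \<open>2 * e'\<close> missing from the square of
    the degree.\<close>
  ultimately have CD': "C' * D' = q ^ (rdeg \<pi>')\<^sup>2"
    unfolding cd by (simp add: power_add[symmetric] mult_2 add_ac)

  let ?\<rho>s = "\<pi>' # replicate k one"
  define e where "e = card (upper_pairs (map rdeg ?\<rho>s))"
  define C where "C = q ^ e * (C' * (- 1) ^ k)"
  define D where "D = q ^ e * (D' * (- 1) ^ k)"
  have rep\<rho>: "\<forall>\<rho>\<in>set ?\<rho>s. is_rep \<rho>" using \<pi>' one by simp
  have pl: "prod_list (c # replicate k (- 1)) = c * (- 1) ^ k" for c :: 'r by simp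
  have la: "list_all2 P (a # replicate k one) (b # replicate k (- 1))" if "P a b" "P one (- 1)"
    for P :: "('k, 'r, 'v) rep \<Rightarrow> 'r \<Rightarrow> bool" and a b
    using that by (simp add: list_all2_conv_all_nth All_less_Suc2)
  have C: "gauss_scalar \<psi> True \<pi> C" unfolding C_def e_def q_def pl[symmetric]
    by (intro gauss_scalar_subquotient[OF vs sq] gauss_scalar_par_ind[OF \<psi> q0 _ rep\<rho>] la C'
      gauss_scalar_trivial(2)[OF \<psi> one])
  have D: "gauss_scalar ?\<chi> False \<pi> D" unfolding D_def e_def q_def pl[symmetric]
    by (intro gauss_scalar_subquotient[OF vs sq] gauss_scalar_par_ind[OF \<chi> q0 _ rep\<rho>] la D'
      gauss_scalar_trivial(2)[OF \<chi> one])
  have deg: "rdeg \<pi> = sum_list (map rdeg ?\<rho>s)" using sq by (simp add: subquotient_def)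
  \<comment> \<open>The \<open>k\<close> blocks of size 1 contribute \<open>k\<close> to the sum of
    squares; this surplus becomes the k-th power of \<open>inverse s\<close>.\<close>
  have m: "(rdeg \<pi>)\<^sup>2 = (rdeg \<pi>')\<^sup>2 + k + 2 * e"
    unfolding deg card_upper_pairs_list e_def
    using gauss_scalar_trivial(1)[OF \<psi> one] by (simp add: sum_list_replicate)

  have nz': "rspace \<pi>' \<noteq> {0}"
    by (rule subquotient_par_ind_nonzero[OF sq \<pi>(2) is_rep_zero[OF \<pi>(1)]])
  have nzd: "rspace (dual_rep \<pi>) \<noteq> {0}"
  proof -
    obtain v where "v \<in> rspace \<pi>" "v \<noteq> 0" using \<pi> is_rep_zero[OF \<pi>(1)] by auto
    from exists_functional[OF \<pi>(1) this] show ?thesis by (metis singletonD zero_fun_def zero_neq_one)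
  qed
  note g = gamma_factor_gauss_scalar[OF \<pi> C, of s]
    and g' = gamma_factor_gauss_scalar[OF \<pi>' nz' C', of s]
    and gd = gamma_factor_gauss_scalar[OF is_rep_dual[OF \<pi>(1)] nzd gauss_scalar_dual[OF \<pi>(1) D], of s]
  have "gamma_factor s \<psi> \<pi> = (- inverse s) ^ k * gamma_factor s \<psi> \<pi>'"
  proof -
    have "(- inverse s) ^ k = (- 1) ^ k * inverse (s ^ k)"
      by (subst power_minus) (simp add: power_inverse)
    moreover have "inverse (s ^ (rdeg \<pi>)\<^sup>2) * q ^ e = inverse (s ^ (rdeg \<pi>')\<^sup>2) * inverse (s ^ k)"
      using s0 unfolding m sq2 power_add power_mult[symmetric] by (simp add: field_simps)
    ultimately show ?thesis unfolding g(2) g'(2) C_def by (simp add: mult_ac)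
  qed
  moreover have "gamma_factor s \<psi> \<pi> * gamma_factor s ?\<chi> (dual_rep \<pi>) = inverse (of_nat (CARD('k)) ^ k)"
  proof -
    \<comment> \<open>The signs cancel, and C D falls short of
      \<open>q ^ (rdeg \<pi>)\<^sup>2\<close> by exactly \<open>q ^ k\<close>.\<close>
    have "((- 1) ^ k * (- 1) ^ k :: 'r) = 1" by (simp flip: power_mult_distrib)
    then have "C * D = q ^ e * q ^ e * (C' * D')" unfolding C_def D_def by (simp add: mult_ac)
    then have CD: "C * D = q ^ (2 * e + (rdeg \<pi>')\<^sup>2)" by (simp add: CD' power_add mult_2)
    have "inverse (s ^ (rdeg \<pi>)\<^sup>2) * inverse (s ^ (rdeg \<pi>)\<^sup>2) = inverse (q ^ (rdeg \<pi>)\<^sup>2)"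
      by (simp add: sq2 power2_eq_square power_mult_distrib)
    also have "\<dots> = inverse (q ^ k) * inverse (q ^ (2 * e + (rdeg \<pi>')\<^sup>2))"
      by (simp add: m power_add mult_ac)
    finally have "inverse (s ^ (rdeg \<pi>)\<^sup>2) * inverse (s ^ (rdeg \<pi>)\<^sup>2) * (C * D) = inverse (q ^ k)"
      unfolding CD using q0 by (simp add: q_def)
    then show ?thesis unfolding g(2) gd(2) by (simp add: q_def mult_ac)
  qed
  ultimately show ?thesis using g(1) g'(1) gd(1) by blast
qed

end
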